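(* Let $M\in\mathbb{R}^{m\times n}$, let $0\le\epsilon<1$, and let $\Omega\in\mathbb{R}^{d\times m}$ be an $\epsilon$-embedding of $\mathrm{range}(M)$. Put $M^{sk}=\Omega M$, let $f>1$ and let $k$ satisfy $1\le k\le\min(m,d)$ and $k<n$. Let $\Pi\in\mathbb{R}^{n\times n}$ be a permutation matrix for which $M^{sk}\Pi=Q^{sk}R^{sk}$ is a strong RRQR factorization of $M^{sk}$ with parameters $k$ and $f$ (that is, a $k$-partial QR factorization with nonsingular leading block $R^{sk}_{11}$ and $\rho(R^{sk},k)\le f$). Consider a $k$-partial QR factorization $M\Pi=QR$ with $$R=\begin{pmatrix}R_{11}&R_{12}\\0&R_{22}\end{pmatrix},\qquad R_{11}\in\mathbb{R}^{k\times k},$$ and set $\tilde f=\sqrt{\frac{1+\epsilon}{1-\epsilon}}\,f$. Then for all $1\le i\le k$ and $1\le j\le n-k$, $$1\le\frac{\sigma_i(M)}{\sigma_i(R_{11})}\le\sqrt{1+\tilde f^{2}k(n-k)},\qquad 1\le\frac{\sigma_j(R_{22})}{\sigma_{j+k}(M)}\le\sqrt{1+\tilde f^{2}k(n-k)},\qquad \left|(R_{11}^{-1}R_{12})_{i,j}\right|\le\tilde f,$$ where the bounds on $\sigma_j(R_{22})/\sigma_{j+k}(M)$ are asserted for those $j$ with $\sigma_{j+k}(M)\neq0$, and $\sigma_j(R_{22})=0$ for those $j$ with $\sigma_{j+k}(M)=0$.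
   Context: All matrices are real; $\sigma_1(A)\ge\sigma_2(A)\ge\cdots$ are the singular values of $A$ in decreasing order, with $\sigma_i(A)=0$ for $i$ larger than the smaller dimension of $A$. $\epsilon$-embedding: $\Omega\in\mathbb{R}^{d\times m}$ is an $\epsilon$-embedding of a subspace $V\subset\mathbb{R}^m$ if $|\langle\Omega x,\Omega y\rangle-\langle x,y\rangle|\le\epsilon\|x\|_2\|y\|_2$ for all $x,y\in V$. $k$-partial QR factorization: for $A\in\mathbb{R}^{p\times n}$, a factorization $A=QR$ with $Q\in\mathbb{R}^{p\times p}$ orthogonal and $R=\begin{pmatrix}R_{11}&R_{12}\\0&R_{22}\end{pmatrix}$, where $R_{11}\in\mathbb{R}^{k\times k}$ is upper triangular, and $R_{12}\in\mathbb{R}^{k\times(n-k)}$, $R_{22}\in\mathbb{R}^{(p-k)\times(n-k)}$ are general. For such $R$ with $R_{11}$ nonsingular, $$\rho(R,k)=\max_{1\le i\le k,\ 1\le j\le n-k}\sqrt{(R_{11}^{-1}R_{12})_{i,j}^2+\omega_i(R_{11})^2\,\gamma_j(R_{22})^2},$$ where $\omega_i(R_{11})$ is the 2-norm of the $i$-th row of $R_{11}^{-1}$ and $\gamma_j(R_{22})$ is the 2-norm of the $j$-th column of $R_{22}$. Strong RRQR factorization of $A$ with parameters $k$ and $f$: a $k$-partial QR factorization $A\Pi=QR$ of $A\Pi$ for some permutation matrix $\Pi$, with $R_{11}$ nonsingular and $\rho(R,k)\le f$ (this is what the deterministic strong RRQR algorithm outputs, whether $k$ is prescribed or determined by a tolerance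 $\tau$). *)

theory Defs
  imports
    "HOL-Computational_Algebra.Polynomial"
    "HOL-Combinatorics.Permutations"
    "HOL-Library.Multiset"
    "Jordan_Normal_Form.Char_Poly"
    "Jordan_Normal_Form.Gauss_Jordan_Elimination"
begin

definition norm2 :: "real vec \<Rightarrow> real" where
  "norm2 v = sqrt (v \<bullet> v)"

text \<open>Positions are numbered from 1, as in the mathematical notation; position 0 is meaningless.
  The eigenvalues of \<open>A\<^sup>T * A\<close> are taken with their algebraic multiplicity, so there are as many of
  them as columns of \<open>A\<close>.\<close>

definition singular_value :: "real mat \<Rightarrow> nat \<Rightarrow> real" where
  "singular_value A i =
     (if 1 \<le> i \<and> i \<le> min (dim_row A) (dim_col A)
      then sqrt (rev (sorted_list_of_multiset (proots (char_poly (A\<^sup>T * A)))) ! (i - 1))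
      else 0)"

definition mat_range :: "real mat \<Rightarrow> real vec set" where
  "mat_range A = (\<lambda>x. A *\<^sub>v x) ` carrier_vec (dim_col A)"

text \<open>Used for linear subspaces \<open>V\<close> only; the inequality itself does not need \<open>V\<close> to be one.\<close>

definition eps_embedding :: "nat \<Rightarrow> nat \<Rightarrow> real \<Rightarrow> real mat \<Rightarrow> real vec set \<Rightarrow> bool" where
  "eps_embedding d m \<epsilon> \<Omega> V \<longleftrightarrow>
     \<Omega> \<in> carrier_mat d m \<and> V \<subseteq> carrier_vec m \<and>
     (\<forall>x\<in>V. \<forall>y\<in>V. \<bar>(\<Omega> *\<^sub>v x) \<bullet> (\<Omega> *\<^sub>v y) - x \<bullet> y\<bar> \<le> \<epsilon> * norm2 x * norm2 y)"

definition permutation_matrix :: "nat \<Rightarrow> real mat \<Rightarrow> bool" where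
  "permutation_matrix n P \<longleftrightarrow>
     (\<exists>\<pi>. \<pi> permutes {..<n} \<and> P = mat n n (\<lambda>(i, j). if i = \<pi> j then 1 else 0))"

text \<open>The constant \<open>orthogonal_mat\<close> of the matrix library only asks the columns to be nonzero and
  pairwise orthogonal, not to have norm 1.\<close>

definition orthonormal_matrix :: "nat \<Rightarrow> real mat \<Rightarrow> bool" where
  "orthonormal_matrix p Q \<longleftrightarrow>
     Q \<in> carrier_mat p p \<and> Q\<^sup>T * Q = 1\<^sub>m p \<and> Q * Q\<^sup>T = 1\<^sub>m p"

text \<open>Unspecified if the matrix is singular.\<close>

abbreviation minv :: "real mat \<Rightarrow> real mat" where
  "minv A \<equiv> the (mat_inverse A)"

definition partial_QR :: "nat \<Rightarrow> real mat \<Rightarrow> real mat \<Rightarrow> real mat \<Rightarrow> bool" where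
  "partial_QR k A Q R \<longleftrightarrow>
     k \<le> dim_row A \<and> k \<le> dim_col A \<and>
     orthonormal_matrix (dim_row A) Q \<and>
     R \<in> carrier_mat (dim_row A) (dim_col A) \<and>
     A = Q * R \<and>
     (case split_block R k k of (R11, R12, R21, R22) \<Rightarrow>
        upper_triangular R11 \<and> R21 = 0\<^sub>m (dim_row A - k) k)"

text \<open>Meant for nonsingular \<open>R11\<close>, \<open>1 \<le> k\<close> and \<open>k < dim_col R\<close>, so that the maximum is over a
  nonempty set. Matrix entries are numbered from 0.\<close>

definition rho :: "real mat \<Rightarrow> nat \<Rightarrow> real" where
  "rho R k =
     (case split_block R k k of (R11, R12, R21, R22) \<Rightarrow>
        Max {sqrt (((minv R11 * R12) $$ (i, j))\<^sup>2
                   + (norm2 (row (minv R11) i))\<^sup>2 * (norm2 (col R22 j))\<^sup>2) |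
             i j. i < k \<and> j < dim_col R - k})"

definition strong_RRQR ::
  "nat \<Rightarrow> real \<Rightarrow> real mat \<Rightarrow> real mat \<Rightarrow> real mat \<Rightarrow> real mat \<Rightarrow> bool" where
  "strong_RRQR k f A P Q R \<longleftrightarrow>
     permutation_matrix (dim_col A) P \<and>
     partial_QR k (A * P) Q R \<and>
     invertible_mat (fst (split_block R k k)) \<and>
     rho R k \<le> f"

end

theory Submission
  imports Defs
begin

text \<open>The pivoting found for the sketch is good for \<open>M\<close> because the quantity that strong rank-revealing
  QR controls is a quotient of distances, and a subspace embedding distorts distances only slightly.

  Let \<open>W\<close> be the inverse of \<open>R11\<close> times \<open>R12\<close>. The number
  \<open>W\<^sub>i\<^sub>j\<^sup>2 + \<omega>\<^sub>i\<^sup>2 \<gamma>\<^sub>j\<^sup>2\<close> is the square of the distance of column \<open>k + j\<close> of the factored matrix from the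
  span of the first \<open>k\<close> columns without column \<open>i\<close>, divided by the square of the distance of column \<open>i\<close>
  from that span (\<open>column_distance_le\<close>, \<open>column_distance_attained\<close>). The sketch changes squared distances
  by factors in the interval from \<open>1 - \<epsilon>\<close> to \<open>1 + \<epsilon>\<close>, hence the quotient by a factor of at most
  \<open>(1 + \<epsilon>) / (1 - \<epsilon>)\<close> (\<open>rho_sq_quasi_isometry\<close>). So \<open>\<rho>(R, k) \<le> ft\<close>, which contains the bound on the
  entries of \<open>W\<close>.

  The bounds on singular values follow from \<open>\<rho>(R, k) \<le> ft\<close> alone. The norm of \<open>R\<close> applied to \<open>(x, y)\<close>
  splits into \<open>R11\<close> applied to \<open>x + W y\<close> and \<open>R22\<close> applied to \<open>y\<close>, so suitable test spaces for
  \<open>R\<close> are obtained from extremal spaces of \<open>R11\<close> and \<open>R22\<close>, and in one case the other way round. The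
  lower bounds 1 are interlacing; in the upper bounds the loss is bounded by one plus the squared
  Frobenius norm of \<open>W\<close> plus the product of the squared Frobenius norms of \<open>R22\<close> and the inverse of \<open>R11\<close>.
  This is one plus the sum of all \<open>W\<^sub>i\<^sub>j\<^sup>2 + \<omega>\<^sub>i\<^sup>2 \<gamma>\<^sub>j\<^sup>2\<close>, at most \<open>1 + ft\<^sup>2 k (n - k)\<close>.

  Test spaces bound singular values by the Courant-Fischer principle (\<open>singular_value_le\<close>,
  \<open>singular_value_ge\<close>), which rests on the spectral theorem for \<open>A\<^sup>T * A\<close> (\<open>spectral_theorem\<close>).\<close>

section \<open>Euclidean estimates for vectors and matrices\<close>

lemma sq_sum: "v \<in> carrier_vec n \<Longrightarrow> v \<bullet> v = (\<Sum>i<n. (v $ i)\<^sup>2)" for v :: "real vec"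
  by (auto simp: scalar_prod_def power2_eq_square atLeast0LessThan)

lemma sq_nonneg: "0 \<le> v \<bullet> v" for v :: "real vec"
  by (auto simp: scalar_prod_def intro: sum_nonneg)

lemma sq_eq_0_iff: "v \<in> carrier_vec n \<Longrightarrow> v \<bullet> v = 0 \<longleftrightarrow> v = 0\<^sub>v n" for v :: "real vec"
  by (auto simp: sq_sum sum_nonneg_eq_0_iff)

lemma sq_pos: "v \<in> carrier_vec n \<Longrightarrow> v \<noteq> 0\<^sub>v n \<Longrightarrow> 0 < v \<bullet> v" for v :: "real vec"
  using sq_nonneg[of v] sq_eq_0_iff[of v n] by linarith

lemma norm2_sq [simp]: "(norm2 v)\<^sup>2 = v \<bullet> v"
  by (simp add: norm2_def sq_nonneg)

lemma sq_add:
  fixes v w :: "real vec"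
  assumes v: "v \<in> carrier_vec n" and w: "w \<in> carrier_vec n"
  shows "(v + w) \<bullet> (v + w) = v \<bullet> v + 2 * (v \<bullet> w) + w \<bullet> w"
proof -
  have "(v + w) \<bullet> (v + w) = v \<bullet> (v + w) + w \<bullet> (v + w)"
    by (rule add_scalar_prod_distrib) (use v w in auto)
  also have "v \<bullet> (v + w) = v \<bullet> v + v \<bullet> w"
    by (rule scalar_prod_add_distrib) (use v w in auto)
  also have "w \<bullet> (v + w) = w \<bullet> v + w \<bullet> w"
    by (rule scalar_prod_add_distrib) (use v w in auto)
  also have "w \<bullet> v = v \<bullet> w"
    by (rule comm_scalar_prod) (use v w in auto)
  finally show ?thesis by simp
qed

lemma Cauchy_Schwarz_vec:
  fixes v w :: "real vec"
  assumes v: "v \<in> carrier_vec n" and w: "w \<in> carrier_vec n"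
  shows "(v \<bullet> w)\<^sup>2 \<le> (v \<bullet> v) * (w \<bullet> w)"
proof (cases "w = 0\<^sub>v n")
  case True
  then show ?thesis using v by simp
next
  case False
  have ww: "w \<bullet> w > 0" by (rule sq_pos[OF w False])
  \<comment> \<open>With these, \<open>s \<cdot>\<^sub>v v + t \<cdot>\<^sub>v w\<close> is a multiple of the component of \<open>v\<close> orthogonal to \<open>w\<close>.\<close>
  define s t where "s = w \<bullet> w" and "t = - (v \<bullet> w)"
  have "0 \<le> (s \<cdot>\<^sub>v v + t \<cdot>\<^sub>v w) \<bullet> (s \<cdot>\<^sub>v v + t \<cdot>\<^sub>v w)"
    by (rule sq_nonneg)
  also have "\<dots> = s * (s * (v \<bullet> v) - (v \<bullet> w)\<^sup>2)"
    using v w by (simp add: sq_add[of _ n] power2_eq_square algebra_simps s_def t_def)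
  finally show ?thesis
    using ww by (simp add: s_def zero_le_mult_iff mult.commute)
qed

definition frob_sq :: "real mat \<Rightarrow> real" where
  "frob_sq A = (\<Sum>i<dim_row A. row A i \<bullet> row A i)"

lemma frob_sq_nonneg: "0 \<le> frob_sq A"
  unfolding frob_sq_def by (intro sum_nonneg sq_nonneg)

lemma frob_sq_entries:
  assumes "A \<in> carrier_mat p n"
  shows "frob_sq A = (\<Sum>i<p. \<Sum>j<n. (A $$ (i, j))\<^sup>2)"
  using assms unfolding frob_sq_def by (auto simp: sq_sum[of _ n] intro!: sum.cong)

lemma frob_sq_cols:
  assumes "A \<in> carrier_mat p n"
  shows "frob_sq A = (\<Sum>j<n. col A j \<bullet> col A j)"
  unfolding frob_sq_entries[OF assms]
  by (subst sum.swap, rule sum.cong) (use assms in \<open>auto simp: sq_sum[of _ p]\<close>)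

lemma sq_mult_mat_vec_le:
  assumes A: "A \<in> carrier_mat p n" and x: "x \<in> carrier_vec n"
  shows "(A *\<^sub>v x) \<bullet> (A *\<^sub>v x) \<le> frob_sq A * (x \<bullet> x)"
proof -
  have "(A *\<^sub>v x) \<bullet> (A *\<^sub>v x) = (\<Sum>i<p. (row A i \<bullet> x)\<^sup>2)"
    using A x by (subst sq_sum[of _ p]) (auto intro!: sum.cong mult_mat_vec_carrier)
  also have "\<dots> \<le> (\<Sum>i<p. (row A i \<bullet> row A i) * (x \<bullet> x))"
    by (intro sum_mono Cauchy_Schwarz_vec[of _ n]) (use A x in auto)
  finally show ?thesis
    using A by (simp add: frob_sq_def sum_distrib_right)
qed

section \<open>The spectral theorem for real symmetric matrices\<close>

lemma symmetric_scalar_prod: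
  fixes A :: "real mat"
  assumes A: "A \<in> carrier_mat n n" "A\<^sup>T = A" and x: "x \<in> carrier_vec n" and y: "y \<in> carrier_vec n"
  shows "y \<bullet> (A *\<^sub>v x) = x \<bullet> (A *\<^sub>v y)"
proof -
  have "y \<bullet> (A *\<^sub>v x) = (A\<^sup>T *\<^sub>v y) \<bullet> x"
    by (rule transpose_vec_mult_scalar[symmetric]) (use A x y in auto)
  also have "\<dots> = x \<bullet> (A *\<^sub>v y)"
    unfolding A(2) by (rule comm_scalar_prod[of _ n]) (use A x y in auto)
  finally show ?thesis .
qed

text \<open>A complex eigenvector \<open>a + \<i> b\<close> for \<open>\<alpha> + \<i> \<beta>\<close> exists by the fundamental theorem of algebra. Splitting
  the eigenvalue equation into real and imaginary part and computing \<open>b \<bullet> (A *\<^sub>v a) = a \<bullet> (A *\<^sub>v b)\<close> in two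
  ways gives \<open>\<beta> * (a \<bullet> a + b \<bullet> b) = 0\<close>, so \<open>\<beta> = 0\<close>, and whichever of \<open>a\<close> and \<open>b\<close> is nonzero is a
  real eigenvector.\<close>

lemma symmetric_has_real_eigenvalue:
  fixes A :: "real mat"
  assumes A: "A \<in> carrier_mat n n" "A\<^sup>T = A" and n: "n > 0"
  shows "\<exists>\<theta>. eigenvalue A \<theta>"
proof -
  let ?C = "map_mat complex_of_real A"
  have C: "?C \<in> carrier_mat n n" using A by auto
  have "degree (char_poly ?C) = n" using degree_monic_char_poly[OF C] by simp
  then have "\<not> constant (poly (char_poly ?C))" using n by (simp add: constant_degree)
  then obtain \<theta> where "poly (char_poly ?C) \<theta> = 0" using fundamental_theorem_of_algebra by blast
  then obtain v where v: "v \<in> carrier_vec n" "v \<noteq> 0\<^sub>v n" "?C *\<^sub>v v = \<theta> \<cdot>\<^sub>v v"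
    using eigenvalue_root_char_poly[OF C, of \<theta>] A(1) unfolding eigenvalue_def eigenvector_def by auto
  define a b \<alpha> \<beta> where defs: "a = map_vec Re v" "b = map_vec Im v" "\<alpha> = Re \<theta>" "\<beta> = Im \<theta>"
  have a: "a \<in> carrier_vec n" and b: "b \<in> carrier_vec n" using v by (auto simp: defs)
  have comp: "(\<Sum>j<n. complex_of_real (A $$ (i, j)) * v $ j) = \<theta> * v $ i" if "i < n" for i
  proof -
    have "(?C *\<^sub>v v) $ i = (\<theta> \<cdot>\<^sub>v v) $ i" using v by simp
    then show ?thesis using that v(1) A(1) by (auto simp: scalar_prod_def atLeast0LessThan)
  qed
  have Aa: "A *\<^sub>v a = \<alpha> \<cdot>\<^sub>v a + (- \<beta>) \<cdot>\<^sub>v b"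
  proof (rule eq_vecI)
    fix i assume "i < dim_vec (\<alpha> \<cdot>\<^sub>v a + (- \<beta>) \<cdot>\<^sub>v b)"
    then have i: "i < n" using b by simp
    show "(A *\<^sub>v a) $ i = (\<alpha> \<cdot>\<^sub>v a + (- \<beta>) \<cdot>\<^sub>v b) $ i"
      using arg_cong[OF comp[OF i], of Re] i v(1) A(1)
      by (auto simp: scalar_prod_def atLeast0LessThan defs)
  qed (use A b in auto)
  have Ab: "A *\<^sub>v b = \<beta> \<cdot>\<^sub>v a + \<alpha> \<cdot>\<^sub>v b"
  proof (rule eq_vecI)
    fix i assume "i < dim_vec (\<beta> \<cdot>\<^sub>v a + \<alpha> \<cdot>\<^sub>v b)"
    then have i: "i < n" using b by simp
    show "(A *\<^sub>v b) $ i = (\<beta> \<cdot>\<^sub>v a + \<alpha> \<cdot>\<^sub>v b) $ i"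
      using arg_cong[OF comp[OF i], of Im] i v(1) A(1)
      by (auto simp: scalar_prod_def atLeast0LessThan defs)
  qed (use A b in auto)
  have ab: "a \<noteq> 0\<^sub>v n \<or> b \<noteq> 0\<^sub>v n"
  proof (rule ccontr)
    assume "\<not> ?thesis"
    then have "a $ i = 0" "b $ i = 0" if "i < n" for i using that by auto
    then have "v = 0\<^sub>v n" using v(1) by (intro eq_vecI) (auto simp: defs complex_eq_iff)
    then show False using v by simp
  qed
  have "b \<bullet> (A *\<^sub>v a) = a \<bullet> (A *\<^sub>v b)"
    by (rule symmetric_scalar_prod[OF A a b])
  then have "\<beta> * (a \<bullet> a + b \<bullet> b) = 0"
    using a b comm_scalar_prod[OF a b] unfolding Aa Ab
    by (simp add: scalar_prod_add_distrib[of _ n] algebra_simps)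
  moreover have "a \<bullet> a + b \<bullet> b > 0"
    using ab sq_pos[OF a] sq_pos[OF b] sq_nonneg[of a] sq_nonneg[of b] by (meson add_nonneg_pos add_pos_nonneg)
  ultimately have \<beta>: "\<beta> = 0" by simp
  have "A *\<^sub>v a = \<alpha> \<cdot>\<^sub>v a" "A *\<^sub>v b = \<alpha> \<cdot>\<^sub>v b" unfolding Aa Ab \<beta> using a b by auto
  then have "eigenvalue A \<alpha>" using ab a b A(1) unfolding eigenvalue_def eigenvector_def by auto
  then show ?thesis ..
qed

lemma symmetric_has_greatest_eigenvalue:
  fixes A :: "real mat"
  assumes A: "A \<in> carrier_mat n n" "A\<^sup>T = A" and n: "n > 0"
  shows "\<exists>\<theta>. eigenvalue A \<theta> \<and> (\<forall>\<mu>. poly (char_poly A) \<mu> = 0 \<longrightarrow> \<mu> \<le> \<theta>)"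
proof -
  let ?S = "{\<mu>. poly (char_poly A) \<mu> = 0}"
  have fin: "finite ?S"
    using degree_monic_char_poly[OF A(1)] n by (intro poly_roots_finite) auto
  have "?S \<noteq> {}"
    using symmetric_has_real_eigenvalue[OF A n] eigenvalue_root_char_poly[OF A(1)] by auto
  then have "Max ?S \<in> ?S" "\<forall>\<mu>\<in>?S. \<mu> \<le> Max ?S"
    using fin Max_in[of ?S] by (blast, simp)
  then show ?thesis using eigenvalue_root_char_poly[OF A(1)] by auto
qed

text \<open>The reflection in the hyperplane orthogonal to \<open>u\<close>. For \<open>u = 0\<close> division by zero makes it the
  identity, so that mapping one unit vector to another needs no special case for equal vectors.\<close>

definition householder :: "nat \<Rightarrow> real vec \<Rightarrow> real mat" where
  "householder n u = mat n n (\<lambda>(i, j). (if i = j then 1 else 0) - 2 / (u \<bullet> u) * (u $ i * u $ j))"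

lemma householder_carrier [simp]: "householder n u \<in> carrier_mat n n"
  and householder_symmetric: "(householder n u)\<^sup>T = householder n u"
  by (auto simp: householder_def)

lemma householder_involution:
  assumes u: "u \<in> carrier_vec n"
  shows "householder n u * householder n u = 1\<^sub>m n"
proof (rule eq_matI)
  fix i j assume "i < dim_row (1\<^sub>m n)" "j < dim_col (1\<^sub>m n)"
  then have ij: "i < n" "j < n" by auto
  define c where "c = 2 / (u \<bullet> u)"
  have c: "c * c * (\<Sum>l<n. (u $ l)\<^sup>2) = 2 * c"
    unfolding sq_sum[OF u, symmetric] c_def by auto
  have "(householder n u * householder n u) $$ (i, j) =
      (\<Sum>l<n. ((if i = l then 1 else 0) - c * (u $ i * u $ l)) *
        ((if l = j then 1 else 0) - c * (u $ l * u $ j)))"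
    using ij by (simp add: householder_def scalar_prod_def atLeast0LessThan c_def)
  also have "\<dots> = (\<Sum>l<n. (if i = l then (if l = j then 1 else 0) - c * (u $ l * u $ j) else 0)
       - (if l = j then c * (u $ i * u $ l) else 0) + c * c * (u $ i * u $ j) * (u $ l)\<^sup>2)"
    by (rule sum.cong) (auto simp: algebra_simps power2_eq_square)
  also have "\<dots> = ((if i = j then 1 else 0) - c * (u $ i * u $ j)) - c * (u $ i * u $ j)
      + (c * c * (\<Sum>l<n. (u $ l)\<^sup>2)) * (u $ i * u $ j)"
    using ij by (simp add: sum.distrib sum_subtractf sum_distrib_left mult_ac)
  also have "\<dots> = (if i = j then 1 else 0)" unfolding c by simp
  finally show "(householder n u * householder n u) $$ (i, j) = 1\<^sub>m n $$ (i, j)"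
    using ij by simp
qed (auto simp: householder_def)

lemma householder_maps_unit_vec:
  assumes v: "v \<in> carrier_vec n" "v \<bullet> v = 1" and n: "n > 0"
  shows "householder n (v - unit_vec n 0) *\<^sub>v unit_vec n 0 = v"
proof -
  define u where "u = v - unit_vec n 0"
  have u: "u \<in> carrier_vec n" using v by (simp add: u_def)
  have "u \<bullet> u = (\<Sum>i<n. (v $ i)\<^sup>2 + (if i = 0 then 1 - 2 * v $ 0 else 0))"
    unfolding sq_sum[OF u] using v
    by (intro sum.cong) (auto simp: u_def power2_eq_square algebra_simps)
  also have "\<dots> = 2 - 2 * v $ 0"
    using n v by (simp add: sum.distrib sq_sum[symmetric])
  finally have uu: "u \<bullet> u = - 2 * u $ 0" using n v by (simp add: u_def)
  have *: "2 / (u \<bullet> u) * (u $ i * u $ 0) = - u $ i" if "i < n" for i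
  proof (cases "u \<bullet> u = 0")
    case True
    then show ?thesis using that sq_eq_0_iff[OF u] by simp
  next
    case False
    then show ?thesis using uu by (simp add: field_simps)
  qed
  have "householder n u *\<^sub>v unit_vec n 0 = v"
  proof (rule eq_vecI)
    fix i assume "i < dim_vec v"
    then have i: "i < n" using v by simp
    show "(householder n u *\<^sub>v unit_vec n 0) $ i = v $ i"
      using i n v *[OF i] by (auto simp: householder_def u_def)
  qed (use v in \<open>auto simp: householder_def\<close>)
  then show ?thesis by (simp add: u_def)
qed

lemma orthonormal_matrix_mult:
  assumes "orthonormal_matrix n U" "orthonormal_matrix n V"
  shows "orthonormal_matrix n (U * V)"
proof -
  have c: "U \<in> carrier_mat n n" "V \<in> carrier_mat n n" "U\<^sup>T \<in> carrier_mat n n" "V\<^sup>T \<in> carrier_mat n n"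
    and e: "U\<^sup>T * U = 1\<^sub>m n" "V\<^sup>T * V = 1\<^sub>m n"
    using assms unfolding orthonormal_matrix_def by auto
  have t: "(U * V)\<^sup>T = V\<^sup>T * U\<^sup>T" by (rule transpose_mult[OF c(1,2)])
  have "(U * V)\<^sup>T * (U * V) = V\<^sup>T * ((U\<^sup>T * U) * V)"
    unfolding t using c
    by (simp add: assoc_mult_mat[of _ n n _ n _ n] mult_carrier_mat[of _ n n _ n])
  also have "\<dots> = 1\<^sub>m n" using e c by simp
  finally have "(U * V)\<^sup>T * (U * V) = 1\<^sub>m n" .
  then show ?thesis unfolding orthonormal_matrix_def
    using mat_mult_left_right_inverse[of "(U * V)\<^sup>T" n "U * V"] c by auto
qed

lemma mult_block_diag:
  fixes A B C D :: "'a :: semiring_1 mat"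
  assumes "A \<in> carrier_mat k k" "B \<in> carrier_mat k k" "C \<in> carrier_mat n n" "D \<in> carrier_mat n n"
  shows "four_block_mat A (0\<^sub>m k n) (0\<^sub>m n k) C * four_block_mat B (0\<^sub>m k n) (0\<^sub>m n k) D
    = four_block_mat (A * B) (0\<^sub>m k n) (0\<^sub>m n k) (C * D)"
  using assms by (subst mult_four_block_mat[of _ k k _ n _ n _ _ k _ n]) (auto intro!: cong_four_block_mat)

text \<open>Deflation: a Householder reflection carries the first basis vector to a unit eigenvector for the
  greatest eigenvalue; by symmetry the conjugated matrix then splits off a one-by-one block, and the
  induction hypothesis applies to the rest. Taking the greatest eigenvalue first delivers the
  eigenvalues already in decreasing order, and carrying the characteristic polynomial through the
  induction shows that the remaining ones do not exceed it.\<close>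

lemma spectral_theorem:
  fixes A :: "real mat"
  assumes "A \<in> carrier_mat n n" "A\<^sup>T = A"
  shows "\<exists>U es. orthonormal_matrix n U \<and> length es = n \<and> sorted_wrt (\<ge>) es \<and>
    A = U * mat_diag n (\<lambda>i. es ! i) * U\<^sup>T \<and> char_poly A = (\<Prod>e\<leftarrow>es. [:- e, 1:])"
  using assms
proof (induction n arbitrary: A)
  case 0
  then have "A = 1\<^sub>m 0" by auto
  then show ?case
    using 0 by (intro exI[of _ "1\<^sub>m 0"] exI[of _ "[]"])
      (auto simp: orthonormal_matrix_def char_poly_upper_triangular[of _ 0] diag_mat_def)
next
  case (Suc n)
  let ?n = "Suc n"
  note A = Suc.prems
  obtain \<theta> where ev: "eigenvalue A \<theta>" and top: "\<And>\<mu>. poly (char_poly A) \<mu> = 0 \<Longrightarrow> \<mu> \<le> \<theta>"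
    using symmetric_has_greatest_eigenvalue[OF A] by auto
  obtain w where w: "w \<in> carrier_vec ?n" "w \<noteq> 0\<^sub>v ?n" "A *\<^sub>v w = \<theta> \<cdot>\<^sub>v w"
    using ev A(1) unfolding eigenvalue_def eigenvector_def by auto
  define v where "v = (1 / sqrt (w \<bullet> w)) \<cdot>\<^sub>v w"
  have v: "v \<in> carrier_vec ?n" "v \<bullet> v = 1" "A *\<^sub>v v = \<theta> \<cdot>\<^sub>v v"
  proof -
    show "v \<in> carrier_vec ?n" using w by (simp add: v_def)
    show "v \<bullet> v = 1" using w sq_pos[OF w(1,2)] by (simp add: v_def field_simps)
    show "A *\<^sub>v v = \<theta> \<cdot>\<^sub>v v"
      unfolding v_def using w A(1) by (simp add: mult_mat_vec smult_smult_assoc mult.commute)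
  qed
  define H where "H = householder ?n (v - unit_vec ?n 0)"
  have H: "H \<in> carrier_mat ?n ?n" "H\<^sup>T = H" "H * H = 1\<^sub>m ?n" "H *\<^sub>v unit_vec ?n 0 = v"
    unfolding H_def using v
    by (auto simp: householder_symmetric householder_involution householder_maps_unit_vec)
  have Hv: "H *\<^sub>v v = unit_vec ?n 0"
  proof -
    have "(H * H) *\<^sub>v unit_vec ?n 0 = H *\<^sub>v v"
      using assoc_mult_mat_vec[OF H(1) H(1), of "unit_vec ?n 0"] H(4) by simp
    then show ?thesis unfolding H(3) using v(1) by simp
  qed
  define B where "B = H * A * H"
  have B: "B \<in> carrier_mat ?n ?n" unfolding B_def using H A by auto
  have Bsym: "B\<^sup>T = B"
    unfolding B_def using H A
    by (simp add: transpose_mult[of _ ?n ?n _ ?n])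
  have Be: "B *\<^sub>v unit_vec ?n 0 = \<theta> \<cdot>\<^sub>v unit_vec ?n 0"
  proof -
    have "B *\<^sub>v unit_vec ?n 0 = H *\<^sub>v (A *\<^sub>v (H *\<^sub>v unit_vec ?n 0))"
      unfolding B_def using H A by (simp add: assoc_mult_mat_vec[of _ ?n ?n _ ?n] mult_carrier_mat[of _ ?n ?n _ ?n])
    also have "\<dots> = \<theta> \<cdot>\<^sub>v (H *\<^sub>v v)"
      unfolding H(4) v(3) by (rule mult_mat_vec[OF H(1) v(1)])
    finally show ?thesis unfolding Hv .
  qed
  have col0: "B $$ (i, 0) = (if i = 0 then \<theta> else 0)" if "i < ?n" for i
    using arg_cong[OF Be, of "\<lambda>x. x $ i"] that B by simp
  have row0: "B $$ (0, i) = (if i = 0 then \<theta> else 0)" if "i < ?n" for i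
  proof -
    have "B\<^sup>T $$ (0, i) = B $$ (0, i)" unfolding Bsym ..
    then show ?thesis using col0[OF that] B that by simp
  qed
  have AB: "A = H * B * H"
  proof -
    have "H * B * H = (H * H) * A * (H * H)" unfolding B_def
      using H(1) A(1) by (simp add: assoc_mult_mat[of _ ?n ?n _ ?n _ ?n] mult_carrier_mat[of _ ?n ?n _ ?n])
    then show ?thesis using H A by simp
  qed
  define L where "L = mat_diag 1 (\<lambda>_. \<theta>)"
  define A' where "A' = mat n n (\<lambda>(i, j). B $$ (Suc i, Suc j))"
  have L: "L \<in> carrier_mat 1 1" and A': "A' \<in> carrier_mat n n" by (auto simp: L_def A'_def)
  have Bblock: "B = four_block_mat L (0\<^sub>m 1 n) (0\<^sub>m n 1) A'"
    using B col0 row0 by (intro eq_matI) (auto simp: L_def A'_def mat_diag_def)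
  have "A'\<^sup>T = A'"
  proof (rule eq_matI)
    fix i j assume "i < dim_row A'" "j < dim_col A'"
    then have "i < n" "j < n" by (auto simp: A'_def)
    moreover have "B\<^sup>T $$ (Suc i, Suc j) = B $$ (Suc i, Suc j)" unfolding Bsym ..
    ultimately show "A'\<^sup>T $$ (i, j) = A' $$ (i, j)" using B by (simp add: A'_def)
  qed (auto simp: A'_def)
  from Suc.IH[OF A' this] obtain V es where V: "orthonormal_matrix n V" and es: "length es = n" "sorted_wrt (\<ge>) es"
    and A'V: "A' = V * mat_diag n (\<lambda>i. es ! i) * V\<^sup>T" and cp': "char_poly A' = (\<Prod>e\<leftarrow>es. [:- e, 1:])"
    by auto
  have "similar_mat_wit A B H H"
    by (rule similar_mat_witI[of _ _ ?n]) (use H A B AB in auto)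
  then have "char_poly A = char_poly B"
    by (intro char_poly_similar) (auto simp: similar_mat_def)
  also have "\<dots> = char_poly L * char_poly A'"
    unfolding Bblock by (rule char_poly_four_block_zeros_col) (use L A' in auto)
  also have "char_poly L = [:- \<theta>, 1:]"
    by (subst char_poly_upper_triangular[OF L]) (auto simp: L_def mat_diag_def diag_mat_def)
  finally have cp: "char_poly A = (\<Prod>e\<leftarrow>\<theta> # es. [:- e, 1:])" by (simp add: cp')
  have "e \<le> \<theta>" if "e \<in> set es" for e
    using that by (intro top) (auto simp: cp poly_prod_list)
  then have sorted: "sorted_wrt (\<ge>) (\<theta> # es)" using es by auto
  define W where "W = four_block_mat (1\<^sub>m 1) (0\<^sub>m 1 n) (0\<^sub>m n 1) V"
  have Vc: "V \<in> carrier_mat n n" "V\<^sup>T * V = 1\<^sub>m n" "V * V\<^sup>T = 1\<^sub>m n"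
    using V by (auto simp: orthonormal_matrix_def)
  have WT: "W\<^sup>T = four_block_mat (1\<^sub>m 1) (0\<^sub>m 1 n) (0\<^sub>m n 1) V\<^sup>T"
    unfolding W_def using Vc by (subst transpose_four_block_mat[of _ 1 1 _ n _ n]) auto
  have one: "four_block_mat (1\<^sub>m 1) (0\<^sub>m 1 n) (0\<^sub>m n 1) (1\<^sub>m n) = 1\<^sub>m (Suc n)"
    using four_block_one_mat[of 1 n] by simp
  have Wc: "W \<in> carrier_mat ?n ?n" using Vc by (auto simp: W_def)
  have "W\<^sup>T * W = four_block_mat (1\<^sub>m 1 * 1\<^sub>m 1) (0\<^sub>m 1 n) (0\<^sub>m n 1) (V\<^sup>T * V)"
    unfolding WT unfolding W_def by (rule mult_block_diag) (use Vc in auto)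
  moreover have "W * W\<^sup>T = four_block_mat (1\<^sub>m 1 * 1\<^sub>m 1) (0\<^sub>m 1 n) (0\<^sub>m n 1) (V * V\<^sup>T)"
    unfolding WT unfolding W_def by (rule mult_block_diag) (use Vc in auto)
  ultimately have "W\<^sup>T * W = 1\<^sub>m ?n" "W * W\<^sup>T = 1\<^sub>m ?n"
    using Vc one by auto
  then have Wo: "orthonormal_matrix ?n W" using Wc by (auto simp: orthonormal_matrix_def)
  have Ho: "orthonormal_matrix ?n H" using H by (auto simp: orthonormal_matrix_def)
  let ?D = "mat_diag n (\<lambda>i. es ! i)" and ?E = "mat_diag ?n (\<lambda>i. (\<theta> # es) ! i)"
  have E: "?E = four_block_mat L (0\<^sub>m 1 n) (0\<^sub>m n 1) ?D"
    by (intro eq_matI) (auto simp: L_def mat_diag_def nth_Cons split: nat.splits)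
  have "W * ?E = four_block_mat (1\<^sub>m 1 * L) (0\<^sub>m 1 n) (0\<^sub>m n 1) (V * ?D)"
    unfolding E W_def by (rule mult_block_diag) (use Vc L in auto)
  then have "W * ?E * W\<^sup>T = four_block_mat (1\<^sub>m 1 * L * 1\<^sub>m 1) (0\<^sub>m 1 n) (0\<^sub>m n 1) (V * ?D * V\<^sup>T)"
    unfolding WT using Vc L
    by (simp only:) (rule mult_block_diag, auto intro!: mult_carrier_mat[of _ n n _ n])
  also have "\<dots> = B" unfolding Bblock A'V using L by simp
  finally have "W * ?E * W\<^sup>T = B" .
  then have "A = H * (W * ?E * W\<^sup>T) * H\<^sup>T" using AB H by simp
  also have "\<dots> = (H * W) * ?E * (H * W)\<^sup>T"
    using H(1) Wc
    by (simp add: transpose_mult[OF H(1) Wc] assoc_mult_mat[of _ ?n ?n _ ?n _ ?n] mult_carrier_mat[of _ ?n ?n _ ?n])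
  finally have "A = (H * W) * ?E * (H * W)\<^sup>T" .
  then show ?case
    using orthonormal_matrix_mult[OF Ho Wo] es sorted cp
    by (intro exI[of _ "H * W"] exI[of _ "\<theta> # es"]) auto
qed

section \<open>The min-max characterisation of singular values\<close>

lemma wide_matrix_kernel:
  fixes A :: "'a :: field mat"
  assumes A: "A \<in> carrier_mat r n" and r: "r < n"
  shows "\<exists>x\<in>carrier_vec n. x \<noteq> 0\<^sub>v n \<and> A *\<^sub>v x = 0\<^sub>v r"
proof -
  \<comment> \<open>Padding by zero rows yields a singular square matrix.\<close>
  define A' where "A' = mat\<^sub>r n n (\<lambda>i. if i = r then 0\<^sub>v n else if i < r then row A i else 0\<^sub>v n)"
  have A': "A' \<in> carrier_mat n n" by (simp add: A'_def)
  have "det A' = 0"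
    unfolding A'_def by (rule det_row_0[OF r]) (use A in auto)
  then obtain x where x: "x \<in> carrier_vec n" "x \<noteq> 0\<^sub>v n" "A' *\<^sub>v x = 0\<^sub>v n"
    using det_0_iff_vec_prod_zero_field[OF A'] by auto
  have "A *\<^sub>v x = 0\<^sub>v r"
  proof (rule eq_vecI)
    fix i assume "i < dim_vec (0\<^sub>v r)"
    then have i: "i < r" by simp
    then have "row A' i = row A i"
      unfolding A'_def using A r by (intro eq_vecI) auto
    moreover have "(A' *\<^sub>v x) $ i = 0" using x i r by simp
    ultimately show "(A *\<^sub>v x) $ i = 0\<^sub>v r $ i" using i r A A' by simp
  qed (use A in auto)
  then show ?thesis using x by blast
qed

lemma orthonormal_sq:
  assumes U: "orthonormal_matrix n U" and x: "x \<in> carrier_vec n"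
  shows "(U *\<^sub>v x) \<bullet> (U *\<^sub>v x) = x \<bullet> x" and "(U\<^sup>T *\<^sub>v x) \<bullet> (U\<^sup>T *\<^sub>v x) = x \<bullet> x"
proof -
  have c: "U \<in> carrier_mat n n" "U\<^sup>T \<in> carrier_mat n n" "U\<^sup>T * U = 1\<^sub>m n" "U * U\<^sup>T = 1\<^sub>m n"
    using U by (auto simp: orthonormal_matrix_def)
  have "(U *\<^sub>v x) \<bullet> (U *\<^sub>v x) = (U\<^sup>T *\<^sub>v (U *\<^sub>v x)) \<bullet> x"
    by (rule transpose_vec_mult_scalar[symmetric]) (use c x in auto)
  also have "U\<^sup>T *\<^sub>v (U *\<^sub>v x) = x"
    using assoc_mult_mat_vec[OF c(2,1) x] c(3) x by simp
  finally show "(U *\<^sub>v x) \<bullet> (U *\<^sub>v x) = x \<bullet> x" .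
  have "(U\<^sup>T *\<^sub>v x) \<bullet> (U\<^sup>T *\<^sub>v x) = x \<bullet> (U *\<^sub>v (U\<^sup>T *\<^sub>v x))"
    by (rule transpose_vec_mult_scalar) (use c x in auto)
  also have "U *\<^sub>v (U\<^sup>T *\<^sub>v x) = x"
    using assoc_mult_mat_vec[OF c(1,2) x] c(4) x by simp
  finally show "(U\<^sup>T *\<^sub>v x) \<bullet> (U\<^sup>T *\<^sub>v x) = x \<bullet> x" .
qed

lemma proots_prod_linear_factors: "proots (\<Prod>e\<leftarrow>es. [:- e, 1:]) = mset es"
  for es :: "'a :: idom list"
proof (induction es)
  case (Cons e es)
  have "(\<Prod>e\<leftarrow>es. [:- e, 1:]) \<noteq> 0" by auto
  then show ?case using Cons by (simp add: proots_mult del: mult_pCons_left)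
qed simp

text \<open>In an orthonormal eigenbasis of \<open>A\<^sup>T * A\<close> the squared norm of \<open>A *\<^sub>v x\<close> is diagonal, with the squared
  singular values as coefficients. The list \<open>es\<close> has one entry for each column of \<open>A\<close>, also where there
  are more columns than rows.\<close>

lemma singular_value_coordinates:
  fixes A :: "real mat"
  assumes A: "A \<in> carrier_mat p n"
  shows "\<exists>U es. orthonormal_matrix n U \<and> length es = n \<and> sorted_wrt (\<ge>) es \<and> (\<forall>l<n. 0 \<le> es ! l) \<and>
    (\<forall>x\<in>carrier_vec n. (A *\<^sub>v x) \<bullet> (A *\<^sub>v x) = (\<Sum>l<n. es ! l * ((U\<^sup>T *\<^sub>v x) $ l)\<^sup>2)) \<and>
    (\<forall>i. 1 \<le> i \<and> i \<le> min p n \<longrightarrow> singular_value A i = sqrt (es ! (i - 1)))"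
proof -
  have G: "A\<^sup>T * A \<in> carrier_mat n n" using A by simp
  have "(A\<^sup>T * A)\<^sup>T = A\<^sup>T * A" using A by (simp add: transpose_mult[of _ n p _ n])
  from spectral_theorem[OF G this] obtain U es where U: "orthonormal_matrix n U"
    and es: "length es = n" "sorted_wrt (\<ge>) es"
    and GU: "A\<^sup>T * A = U * mat_diag n (\<lambda>i. es ! i) * U\<^sup>T" and cp: "char_poly (A\<^sup>T * A) = (\<Prod>e\<leftarrow>es. [:- e, 1:])"
    by blast
  let ?D = "mat_diag n (\<lambda>i. es ! i)"
  have c: "U \<in> carrier_mat n n" "U\<^sup>T \<in> carrier_mat n n" "U\<^sup>T * U = 1\<^sub>m n"
    using U by (auto simp: orthonormal_matrix_def)
  have quad: "(A *\<^sub>v x) \<bullet> (A *\<^sub>v x) = (\<Sum>l<n. es ! l * ((U\<^sup>T *\<^sub>v x) $ l)\<^sup>2)" if x: "x \<in> carrier_vec n" for x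
  proof -
    define y where "y = U\<^sup>T *\<^sub>v x"
    have y: "y \<in> carrier_vec n" unfolding y_def by (rule mult_mat_vec_carrier[OF c(2) x])
    have Dy: "?D *\<^sub>v y \<in> carrier_vec n" by (rule mult_mat_vec_carrier[OF _ y]) simp
    have "(A *\<^sub>v x) \<bullet> (A *\<^sub>v x) = (A\<^sup>T *\<^sub>v (A *\<^sub>v x)) \<bullet> x"
      by (rule transpose_vec_mult_scalar[symmetric]) (use A x in auto)
    also have "A\<^sup>T *\<^sub>v (A *\<^sub>v x) = (A\<^sup>T * A) *\<^sub>v x"
      by (rule assoc_mult_mat_vec[symmetric]) (use A x in auto)
    also have "\<dots> = U *\<^sub>v (?D *\<^sub>v y)"
      unfolding GU y_def using c x
      by (simp add: assoc_mult_mat_vec[of _ n n _ n] mult_carrier_mat[of _ n n _ n])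
    also have "\<dots> \<bullet> x = x \<bullet> (U *\<^sub>v (?D *\<^sub>v y))"
      by (rule comm_scalar_prod[OF _ x]) (rule mult_mat_vec_carrier[OF c(1) Dy])
    also have "\<dots> = y \<bullet> (?D *\<^sub>v y)"
      by (subst y_def) (rule transpose_vec_mult_scalar[OF c(1) Dy x, symmetric])
    also have "\<dots> = (\<Sum>l<n. es ! l * (y $ l)\<^sup>2)"
    proof -
      have "(?D *\<^sub>v y) $ l = es ! l * y $ l" if "l < n" for l
        using that y by (simp add: mat_diag_def scalar_prod_def sum.delta if_distrib[of "\<lambda>t. t * _"] cong: if_cong)
      moreover have "dim_vec (?D *\<^sub>v y) = n" by (simp add: mat_diag_def)
      ultimately show ?thesis
        unfolding scalar_prod_def by (auto simp: atLeast0LessThan power2_eq_square intro!: sum.cong)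
    qed
    finally show ?thesis unfolding y_def .
  qed
  have nonneg: "0 \<le> es ! l" if l: "l < n" for l
  proof -
    have "U\<^sup>T *\<^sub>v (U *\<^sub>v unit_vec n l) = unit_vec n l"
      using assoc_mult_mat_vec[OF c(2,1), of "unit_vec n l"] c(3) by simp
    then have "(A *\<^sub>v (U *\<^sub>v unit_vec n l)) \<bullet> (A *\<^sub>v (U *\<^sub>v unit_vec n l)) = (\<Sum>i<n. es ! i * (unit_vec n l $ i)\<^sup>2)"
      using quad[of "U *\<^sub>v unit_vec n l"] c by simp
    also have "\<dots> = (\<Sum>i<n. if i = l then es ! l else 0)"
      using l by (intro sum.cong) auto
    also have "\<dots> = es ! l" using l by simp
    finally show ?thesis using sq_nonneg by metis
  qed
  have "proots (char_poly (A\<^sup>T * A)) = mset es"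
    unfolding cp by (rule proots_prod_linear_factors)
  moreover have "sorted (rev es)"
    using es by (simp add: sorted_wrt_rev)
  ultimately have "rev (sorted_list_of_multiset (proots (char_poly (A\<^sup>T * A)))) = es"
    using properties_for_sort[of "rev es" es] by simp
  then have "singular_value A i = sqrt (es ! (i - 1))" if "1 \<le> i \<and> i \<le> min p n" for i
    using that A unfolding singular_value_def by auto
  then show ?thesis using U es nonneg quad by blast
qed

lemma singular_value_nonneg: "0 \<le> singular_value A i"
proof (cases "1 \<le> i \<and> i \<le> min (dim_row A) (dim_col A)")
  case True
  from singular_value_coordinates[OF carrier_matI[OF refl refl, of A]] obtain es :: "real list"
    where "\<forall>l<dim_col A. 0 \<le> es ! l"
    and "\<forall>i. 1 \<le> i \<and> i \<le> min (dim_row A) (dim_col A) \<longrightarrow> singular_value A i = sqrt (es ! (i - 1))"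
    by blast
  then show ?thesis using True by auto
next
  case False
  then show ?thesis unfolding singular_value_def by auto
qed

text \<open>The witness is the span of the first \<open>i\<close> eigenvectors. Subspaces of dimension \<open>i\<close> are given as ranges of
  injective matrices \<open>B\<close> with \<open>i\<close> columns.\<close>

lemma singular_value_lower_subspace:
  fixes A :: "real mat"
  assumes A: "A \<in> carrier_mat p n" and i: "1 \<le> i" "i \<le> min p n"
  shows "\<exists>B\<in>carrier_mat n i. \<forall>t\<in>carrier_vec i. (B *\<^sub>v t) \<bullet> (B *\<^sub>v t) = t \<bullet> t \<and>
    (singular_value A i)\<^sup>2 * (t \<bullet> t) \<le> (A *\<^sub>v (B *\<^sub>v t)) \<bullet> (A *\<^sub>v (B *\<^sub>v t))"
proof -
  from singular_value_coordinates[OF A] obtain U es where U: "orthonormal_matrix n U"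
    and es: "length es = n" "sorted_wrt (\<ge>) es" "\<forall>l<n. 0 \<le> es ! l"
    and quad: "\<forall>x\<in>carrier_vec n. (A *\<^sub>v x) \<bullet> (A *\<^sub>v x) = (\<Sum>l<n. es ! l * ((U\<^sup>T *\<^sub>v x) $ l)\<^sup>2)"
    and sv: "singular_value A i = sqrt (es ! (i - 1))"
    using i by blast
  have c: "U \<in> carrier_mat n n" "U\<^sup>T \<in> carrier_mat n n" "U\<^sup>T * U = 1\<^sub>m n"
    using U by (auto simp: orthonormal_matrix_def)
  define E :: "real mat" where "E = mat n i (\<lambda>(a, b). if a = b then 1 else 0)"
  have E: "E \<in> carrier_mat n i" by (simp add: E_def)
  have Et: "(E *\<^sub>v t) $ l = (if l < i then t $ l else 0)" if "l < n" "t \<in> carrier_vec i" for l t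
    using that by (simp add: E_def scalar_prod_def if_distrib[of "\<lambda>t. t * _"] cong: if_cong)
  have *: "((U * E) *\<^sub>v t) \<bullet> ((U * E) *\<^sub>v t) = t \<bullet> t \<and>
      (singular_value A i)\<^sup>2 * (t \<bullet> t) \<le> (A *\<^sub>v ((U * E) *\<^sub>v t)) \<bullet> (A *\<^sub>v ((U * E) *\<^sub>v t))"
    if t: "t \<in> carrier_vec i" for t
  proof -
    define x where "x = E *\<^sub>v t"
    have x: "x \<in> carrier_vec n" using E t by (auto simp: x_def)
    have UE: "(U * E) *\<^sub>v t = U *\<^sub>v x"
      unfolding x_def by (rule assoc_mult_mat_vec[OF c(1) E t])
    have UUx: "U\<^sup>T *\<^sub>v (U *\<^sub>v x) = x"
      using assoc_mult_mat_vec[OF c(2,1) x] c(3) x by simp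
    have split: "(\<Sum>l<n. f l * (x $ l)\<^sup>2) = (\<Sum>l<i. f l * (t $ l)\<^sup>2)" for f :: "nat \<Rightarrow> real"
    proof -
      have "(\<Sum>l<n. f l * (x $ l)\<^sup>2) = (\<Sum>l<n. if l < i then f l * (t $ l)\<^sup>2 else 0)"
        unfolding x_def using Et t by (intro sum.cong) auto
      also have "\<dots> = (\<Sum>l\<in>{..<n} \<inter> {l. l < i}. f l * (t $ l)\<^sup>2)"
        by (simp add: sum.inter_restrict)
      also have "{..<n} \<inter> {l. l < i} = {..<i}" using i by auto
      finally show ?thesis .
    qed
    have "x \<bullet> x = t \<bullet> t"
      using split[of "\<lambda>_. 1"] by (simp add: sq_sum[OF x] sq_sum[OF t])
    moreover have "(singular_value A i)\<^sup>2 * (t \<bullet> t) \<le> (\<Sum>l<i. es ! l * (t $ l)\<^sup>2)"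
      unfolding sq_sum[OF t] sum_distrib_left
    proof (intro sum_mono mult_right_mono)
      fix l assume "l \<in> {..<i}"
      then have "l \<le> i - 1" "i - 1 < length es" using i es by auto
      then have "es ! (i - 1) \<le> es ! l"
        using es(2) by (cases "l = i - 1") (auto simp: sorted_wrt_iff_nth_less)
      moreover have "0 \<le> es ! (i - 1)" using es(3) i by auto
      ultimately show "(singular_value A i)\<^sup>2 \<le> es ! l" by (simp add: sv)
    qed simp
    moreover have "(A *\<^sub>v (U *\<^sub>v x)) \<bullet> (A *\<^sub>v (U *\<^sub>v x)) = (\<Sum>l<i. es ! l * (t $ l)\<^sup>2)"
      using bspec[OF quad mult_mat_vec_carrier[OF c(1) x]] unfolding UUx split .
    ultimately show ?thesis unfolding UE by (simp add: orthonormal_sq[OF U x])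
  qed
  show ?thesis
    by (rule bexI[of _ "U * E"]) (use * c E in auto)
qed

text \<open>The witness is the orthogonal complement of the first \<open>i - 1\<close> eigenvectors. Subspaces of codimension at most
  \<open>i - 1\<close> are given as kernels of matrices \<open>C\<close> with \<open>i - 1\<close> rows. If \<open>i\<close> exceeds the number of rows of \<open>A\<close>,
  the singular value is 0 by convention, and the kernel of \<open>A\<close> itself serves.\<close>

lemma singular_value_upper_subspace:
  fixes A :: "real mat"
  assumes A: "A \<in> carrier_mat p n" and i: "1 \<le> i" "i \<le> n"
  shows "\<exists>C\<in>carrier_mat (i - 1) n. \<forall>x\<in>carrier_vec n. C *\<^sub>v x = 0\<^sub>v (i - 1) \<longrightarrow>
    (A *\<^sub>v x) \<bullet> (A *\<^sub>v x) \<le> (singular_value A i)\<^sup>2 * (x \<bullet> x)"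
proof (cases "i \<le> p")
  case True
  then have "i \<le> min p n" using i by simp
  from singular_value_coordinates[OF A] obtain U es where U: "orthonormal_matrix n U"
    and es: "length es = n" "sorted_wrt (\<ge>) es" "\<forall>l<n. 0 \<le> es ! l"
    and quad: "\<forall>x\<in>carrier_vec n. (A *\<^sub>v x) \<bullet> (A *\<^sub>v x) = (\<Sum>l<n. es ! l * ((U\<^sup>T *\<^sub>v x) $ l)\<^sup>2)"
    and sv: "singular_value A i = sqrt (es ! (i - 1))"
    using i \<open>i \<le> min p n\<close> by blast
  have c: "U \<in> carrier_mat n n" "U\<^sup>T \<in> carrier_mat n n"
    using U by (auto simp: orthonormal_matrix_def)
  define C where "C = mat (i - 1) n (\<lambda>(a, b). U\<^sup>T $$ (a, b))"
  have *: "(A *\<^sub>v x) \<bullet> (A *\<^sub>v x) \<le> (singular_value A i)\<^sup>2 * (x \<bullet> x)"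
    if x: "x \<in> carrier_vec n" and Cx: "C *\<^sub>v x = 0\<^sub>v (i - 1)" for x
  proof -
    define y where "y = U\<^sup>T *\<^sub>v x"
    have y: "y \<in> carrier_vec n" unfolding y_def by (rule mult_mat_vec_carrier[OF c(2) x])
    have zero: "y $ l = 0" if l: "l < i - 1" for l
    proof -
      have "row C l = row (U\<^sup>T) l"
        using l i c by (intro eq_vecI) (auto simp: C_def)
      moreover have "(C *\<^sub>v x) $ l = 0" using Cx l by simp
      ultimately show ?thesis using l i c by (simp add: y_def C_def)
    qed
    have "(A *\<^sub>v x) \<bullet> (A *\<^sub>v x) = (\<Sum>l<n. es ! l * (y $ l)\<^sup>2)"
      unfolding y_def using quad x by blast
    also have "\<dots> \<le> (\<Sum>l<n. (singular_value A i)\<^sup>2 * (y $ l)\<^sup>2)"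
    proof (rule sum_mono)
      fix l assume l: "l \<in> {..<n}"
      show "es ! l * (y $ l)\<^sup>2 \<le> (singular_value A i)\<^sup>2 * (y $ l)\<^sup>2"
      proof (cases "l < i - 1")
        case False
        then have "es ! l \<le> es ! (i - 1)"
          using es(1,2) l by (cases "l = i - 1") (auto simp: sorted_wrt_iff_nth_less)
        then show ?thesis using es(3) i by (intro mult_right_mono) (auto simp: sv)
      qed (simp add: zero)
    qed
    also have "\<dots> = (singular_value A i)\<^sup>2 * (y \<bullet> y)"
      by (simp add: sq_sum[OF y] sum_distrib_left)
    also have "y \<bullet> y = x \<bullet> x" unfolding y_def by (rule orthonormal_sq[OF U x])
    finally show ?thesis .
  qed
  show ?thesis by (rule bexI[of _ C]) (use * in \<open>auto simp: C_def\<close>)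
next
  case False
  define C where "C = mat (i - 1) n (\<lambda>(a, b). if a < p then A $$ (a, b) else 0)"
  have *: "A *\<^sub>v x = 0\<^sub>v p" if x: "x \<in> carrier_vec n" and Cx: "C *\<^sub>v x = 0\<^sub>v (i - 1)" for x
  proof (rule eq_vecI)
    fix l assume "l < dim_vec (0\<^sub>v p)"
    then have l: "l < p" "l < i - 1" using False by auto
    have "row C l = row A l" using l A by (intro eq_vecI) (auto simp: C_def)
    moreover have "(C *\<^sub>v x) $ l = 0" using Cx l by simp
    ultimately show "(A *\<^sub>v x) $ l = 0\<^sub>v p $ l" using l A by (simp add: C_def)
  qed (use A in auto)
  show ?thesis
    by (rule bexI[of _ C]) (use * in \<open>auto simp: C_def sq_nonneg\<close>)
qed

text \<open>This lemma and the next are the two halves of the Courant-Fischer theorem: for dimension reasons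
  the test space meets the extremal space of the opposite kind in a nonzero vector, on which both
  estimates hold.\<close>

lemma singular_value_le:
  fixes A :: "real mat"
  assumes A: "A \<in> carrier_mat p n" and i: "1 \<le> i" and c: "0 \<le> c" and C: "C \<in> carrier_mat (i - 1) n"
    and bound: "\<And>x. x \<in> carrier_vec n \<Longrightarrow> C *\<^sub>v x = 0\<^sub>v (i - 1) \<Longrightarrow> (A *\<^sub>v x) \<bullet> (A *\<^sub>v x) \<le> c\<^sup>2 * (x \<bullet> x)"
  shows "singular_value A i \<le> c"
proof (cases "i \<le> min p n")
  case True
  obtain B where B: "B \<in> carrier_mat n i"
    and Bt: "\<And>t. t \<in> carrier_vec i \<Longrightarrow> (B *\<^sub>v t) \<bullet> (B *\<^sub>v t) = t \<bullet> t"
      "\<And>t. t \<in> carrier_vec i \<Longrightarrow> (singular_value A i)\<^sup>2 * (t \<bullet> t) \<le> (A *\<^sub>v (B *\<^sub>v t)) \<bullet> (A *\<^sub>v (B *\<^sub>v t))"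
    using singular_value_lower_subspace[OF A i True] by blast
  have "C * B \<in> carrier_mat (i - 1) i" using B C by simp
  then obtain t where t: "t \<in> carrier_vec i" "t \<noteq> 0\<^sub>v i" "(C * B) *\<^sub>v t = 0\<^sub>v (i - 1)"
    using wide_matrix_kernel[of "C * B" "i - 1" i] i by auto
  have x: "B *\<^sub>v t \<in> carrier_vec n" using B t by auto
  have "C *\<^sub>v (B *\<^sub>v t) = 0\<^sub>v (i - 1)" using assoc_mult_mat_vec[OF C B t(1)] t(3) by simp
  from bound[OF x this] Bt[OF t(1)] have "(singular_value A i)\<^sup>2 * (t \<bullet> t) \<le> c\<^sup>2 * (t \<bullet> t)" by simp
  then have "(singular_value A i)\<^sup>2 \<le> c\<^sup>2" using sq_pos[OF t(1,2)] by simp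
  then show ?thesis using c by (rule power2_le_imp_le)
qed (use A c in \<open>auto simp: singular_value_def\<close>)

lemma singular_value_ge:
  fixes A :: "real mat"
  assumes A: "A \<in> carrier_mat p n" and i: "1 \<le> i" "i \<le> n" and B: "B \<in> carrier_mat n i"
    and inj: "\<And>t. t \<in> carrier_vec i \<Longrightarrow> B *\<^sub>v t = 0\<^sub>v n \<Longrightarrow> t = 0\<^sub>v i"
    and bound: "\<And>t. t \<in> carrier_vec i \<Longrightarrow> c\<^sup>2 * ((B *\<^sub>v t) \<bullet> (B *\<^sub>v t)) \<le> (A *\<^sub>v (B *\<^sub>v t)) \<bullet> (A *\<^sub>v (B *\<^sub>v t))"
  shows "c \<le> singular_value A i"
proof -
  obtain C where C: "C \<in> carrier_mat (i - 1) n" and Cx: "\<And>x. x \<in> carrier_vec n \<Longrightarrow> C *\<^sub>v x = 0\<^sub>v (i - 1) \<Longrightarrow>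
      (A *\<^sub>v x) \<bullet> (A *\<^sub>v x) \<le> (singular_value A i)\<^sup>2 * (x \<bullet> x)"
    using singular_value_upper_subspace[OF A i] by blast
  have "C * B \<in> carrier_mat (i - 1) i" using B C by simp
  then obtain t where t: "t \<in> carrier_vec i" "t \<noteq> 0\<^sub>v i" "(C * B) *\<^sub>v t = 0\<^sub>v (i - 1)"
    using wide_matrix_kernel[of "C * B" "i - 1" i] i by auto
  have x: "B *\<^sub>v t \<in> carrier_vec n" "B *\<^sub>v t \<noteq> 0\<^sub>v n" using B t inj by auto
  have "C *\<^sub>v (B *\<^sub>v t) = 0\<^sub>v (i - 1)" using assoc_mult_mat_vec[OF C B t(1)] t(3) by simp
  from Cx[OF x(1) this] bound[OF t(1)]
  have "c\<^sup>2 * ((B *\<^sub>v t) \<bullet> (B *\<^sub>v t)) \<le> (singular_value A i)\<^sup>2 * ((B *\<^sub>v t) \<bullet> (B *\<^sub>v t))" by simp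
  then have "c\<^sup>2 \<le> (singular_value A i)\<^sup>2" using sq_pos[OF x] by simp
  then show ?thesis using singular_value_nonneg by (rule power2_le_imp_le)
qed

section \<open>Block triangular matrices\<close>

lemma split_vec:
  assumes "z \<in> carrier_vec (k + q)"
  obtains x y where "x \<in> carrier_vec k" "y \<in> carrier_vec q" "z = x @\<^sub>v y"
  using assms by (metis vec_first_carrier vec_first_last_append vec_last_carrier)

lemma sq_append:
  fixes x y :: "real vec"
  assumes "x \<in> carrier_vec k" "y \<in> carrier_vec q"
  shows "(x @\<^sub>v y) \<bullet> (x @\<^sub>v y) = x \<bullet> x + y \<bullet> y"
  by (rule scalar_prod_append) (use assms in auto)

lemma zero_mat_mult_vec: "x \<in> carrier_vec n \<Longrightarrow> 0\<^sub>m p n *\<^sub>v x = 0\<^sub>v p"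
  for x :: "'a :: semiring_0 vec"
  by (intro eq_vecI) auto

lemma mat_mult_zero_vec: "A \<in> carrier_mat p n \<Longrightarrow> A *\<^sub>v 0\<^sub>v n = 0\<^sub>v p"
  for A :: "'a :: semiring_0 mat"
  by (intro eq_vecI) auto

lemma vec_diff_add_cancel: "a \<in> carrier_vec n \<Longrightarrow> b \<in> carrier_vec n \<Longrightarrow> a - b + b = a"
  for a b :: "'a :: ring vec"
  by (intro eq_vecI) auto

text \<open>The weighted form of \<open>(sqrt (a * X) + sqrt (b * Y))\<^sup>2 \<le> (a + b) * (X + Y)\<close>: this is what lets the
  contributions of the blocks to a norm be added up under one common factor.\<close>

lemma sq_add_scaled_le:
  fixes u v :: "real vec"
  assumes u: "u \<in> carrier_vec n" and v: "v \<in> carrier_vec n" and h: "0 \<le> a" "0 \<le> b"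
    and uu: "u \<bullet> u \<le> a * X" and vv: "v \<bullet> v \<le> b * Y" and XY: "0 \<le> X" "0 \<le> Y"
  shows "(u + v) \<bullet> (u + v) \<le> (a + b) * (X + Y)"
proof -
  have "(u \<bullet> v)\<^sup>2 \<le> (u \<bullet> u) * (v \<bullet> v)" by (rule Cauchy_Schwarz_vec[OF u v])
  also have "\<dots> \<le> (a * X) * (b * Y)"
    using uu vv h XY by (intro mult_mono) (auto simp: sq_nonneg)
  also have "4 * \<dots> \<le> (a * Y + b * X)\<^sup>2"
    using sum_squares_bound[of "a * Y" "b * X"] by (simp add: power2_eq_square algebra_simps)
  finally have "(2 * (u \<bullet> v))\<^sup>2 \<le> (a * Y + b * X)\<^sup>2" by (simp add: power2_eq_square)
  then have "2 * (u \<bullet> v) \<le> a * Y + b * X"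
    using h XY by (meson add_nonneg_nonneg mult_nonneg_nonneg power2_le_imp_le)
  then show ?thesis
    unfolding sq_add[OF u v] using uu vv by (simp add: algebra_simps)
qed

text \<open>The triangular factor of a partial QR factorization, with \<open>V\<close> the inverse of the leading block.
  Since \<open>R11 *\<^sub>v x + R12 *\<^sub>v y = R11 *\<^sub>v (x + W *\<^sub>v y)\<close> for \<open>W = V * R12\<close>, the substitution
  \<open>u = x + W *\<^sub>v y\<close> decouples the norm of \<open>R *\<^sub>v (x @\<^sub>v y)\<close> into a part in \<open>u\<close> and a part in \<open>y\<close>.\<close>

locale block_triangular =
  fixes R11 V R12 R22 :: "real mat" and k q r :: nat
  assumes R11: "R11 \<in> carrier_mat k k" and V: "V \<in> carrier_mat k k"
    and R12: "R12 \<in> carrier_mat k q" and R22: "R22 \<in> carrier_mat r q"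
    and VR11: "V * R11 = 1\<^sub>m k" and R11V: "R11 * V = 1\<^sub>m k"
begin

definition R :: "real mat" where "R = four_block_mat R11 R12 (0\<^sub>m r k) R22"

definition W :: "real mat" where "W = V * R12"

definition \<omega>sq :: "nat \<Rightarrow> real" where "\<omega>sq i = row V i \<bullet> row V i"

definition \<gamma>sq :: "nat \<Rightarrow> real" where "\<gamma>sq j = col R22 j \<bullet> col R22 j"

lemma R: "R \<in> carrier_mat (k + r) (k + q)"
  unfolding R_def using R11 R22 by simp

lemma W: "W \<in> carrier_mat k q"
  unfolding W_def using V R12 by simp

lemma VR11_vec: "x \<in> carrier_vec k \<Longrightarrow> V *\<^sub>v (R11 *\<^sub>v x) = x"
  using assoc_mult_mat_vec[OF V R11] VR11 by simp

lemma R11V_vec: "x \<in> carrier_vec k \<Longrightarrow> R11 *\<^sub>v (V *\<^sub>v x) = x"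
  using assoc_mult_mat_vec[OF R11 V] R11V by simp

lemma R_vec:
  assumes x: "x \<in> carrier_vec k" and y: "y \<in> carrier_vec q"
  shows "R *\<^sub>v (x @\<^sub>v y) = (R11 *\<^sub>v (x + W *\<^sub>v y)) @\<^sub>v (R22 *\<^sub>v y)"
proof -
  have Wy: "W *\<^sub>v y \<in> carrier_vec k" using W y by auto
  have "R11 *\<^sub>v (W *\<^sub>v y) = R12 *\<^sub>v y"
    unfolding W_def using R11V_vec[of "R12 *\<^sub>v y"] R12 V y by (simp add: assoc_mult_mat_vec[OF V R12 y] mult_mat_vec_carrier[OF R12 y])
  then have "R11 *\<^sub>v (x + W *\<^sub>v y) = R11 *\<^sub>v x + R12 *\<^sub>v y"
    by (simp add: mult_add_distrib_mat_vec[OF R11 x Wy])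
  moreover have "0\<^sub>m r k *\<^sub>v x + R22 *\<^sub>v y = R22 *\<^sub>v y"
    using mult_mat_vec_carrier[OF R22 y] by (simp add: zero_mat_mult_vec[OF x])
  ultimately show ?thesis
    unfolding R_def by (simp add: four_block_mat_mult_vec[OF R11 R12 zero_carrier_mat R22 x y])
qed

lemma sq_R_vec:
  assumes x: "x \<in> carrier_vec k" and y: "y \<in> carrier_vec q"
  shows "(R *\<^sub>v (x @\<^sub>v y)) \<bullet> (R *\<^sub>v (x @\<^sub>v y)) =
    (R11 *\<^sub>v (x + W *\<^sub>v y)) \<bullet> (R11 *\<^sub>v (x + W *\<^sub>v y)) + (R22 *\<^sub>v y) \<bullet> (R22 *\<^sub>v y)"
  unfolding R_vec[OF assms] by (rule sq_append[of _ k _ r]) (use R11 R22 W x y in auto)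

subsection \<open>The entries of rho as quotients of distances\<close>

definition rho_sq :: "nat \<Rightarrow> nat \<Rightarrow> real" where
  "rho_sq i j = (W $$ (i, j))\<^sup>2 + \<omega>sq i * \<gamma>sq j"

lemma \<omega>sq_pos:
  assumes i: "i < k"
  shows "0 < \<omega>sq i"
proof -
  have "row V i \<noteq> 0\<^sub>v k"
  proof
    assume "row V i = 0\<^sub>v k"
    moreover have "row V i \<bullet> col R11 i = (V * R11) $$ (i, i)" using V R11 i by simp
    ultimately show False using R11 i VR11 by simp
  qed
  then show ?thesis
    unfolding \<omega>sq_def using sq_pos[of "row V i" k] V by auto
qed

lemma sq_R22_unit:
  assumes j: "j < q"
  shows "(R22 *\<^sub>v (c \<cdot>\<^sub>v unit_vec q j)) \<bullet> (R22 *\<^sub>v (c \<cdot>\<^sub>v unit_vec q j)) = c\<^sup>2 * \<gamma>sq j"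
proof -
  have "R22 *\<^sub>v unit_vec q j = col R22 j"
    using R22 j by (intro eq_vecI) auto
  then have "R22 *\<^sub>v (c \<cdot>\<^sub>v unit_vec q j) = c \<cdot>\<^sub>v col R22 j"
    by (simp add: mult_mat_vec[OF R22])
  then show ?thesis
    using R22 j by (simp add: \<gamma>sq_def power2_eq_square)
qed

lemma W_unit_index:
  assumes "i < k" "j < q"
  shows "(W *\<^sub>v (c \<cdot>\<^sub>v unit_vec q j)) $ i = c * W $$ (i, j)"
  using assms W by simp

text \<open>Geometrically, for \<open>b = 1\<close> and \<open>c = 0\<close> the minimum of the squared norm over \<open>x\<close> is the squared distance of
  column \<open>i\<close> of \<open>R\<close> from the span of the other leading columns, which is \<open>1 / \<omega>sq i\<close>; for \<open>b = 0\<close> and \<open>c = 1\<close>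
  it is the squared distance of column \<open>k + j\<close> from the same span, which is \<open>rho_sq i j / \<omega>sq i\<close>. So
  \<open>rho_sq i j\<close> is a quotient of two squared distances. The bound is Cauchy-Schwarz for row \<open>i\<close> of \<open>V\<close>.\<close>

lemma column_distance_le:
  assumes i: "i < k" and j: "j < q" and x: "x \<in> carrier_vec k" "x $ i = b"
  shows "(b + c * W $$ (i, j))\<^sup>2 + c\<^sup>2 * (\<omega>sq i * \<gamma>sq j) \<le>
    \<omega>sq i * ((R *\<^sub>v (x @\<^sub>v c \<cdot>\<^sub>v unit_vec q j)) \<bullet> (R *\<^sub>v (x @\<^sub>v c \<cdot>\<^sub>v unit_vec q j)))"
proof -
  let ?y = "c \<cdot>\<^sub>v unit_vec q j"
  define u where "u = x + W *\<^sub>v ?y"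
  have y: "?y \<in> carrier_vec q" by simp
  have u: "u \<in> carrier_vec k" using x mult_mat_vec_carrier[OF W y] by (simp add: u_def)
  have "row V i \<bullet> (R11 *\<^sub>v u) = u $ i"
    using arg_cong[OF VR11_vec[OF u], of "\<lambda>w. w $ i"] V i by simp
  also have "\<dots> = b + c * W $$ (i, j)"
    unfolding u_def using x i mult_mat_vec_carrier[OF W y] W_unit_index[OF i j] W by simp
  finally have "(b + c * W $$ (i, j))\<^sup>2 \<le> \<omega>sq i * ((R11 *\<^sub>v u) \<bullet> (R11 *\<^sub>v u))"
    using Cauchy_Schwarz_vec[of "row V i" k "R11 *\<^sub>v u"] V R11 u by (auto simp: \<omega>sq_def)
  then show ?thesis
    unfolding sq_R_vec[OF x(1) y] sq_R22_unit[OF j] u_def[symmetric] by (simp add: algebra_simps)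
qed

text \<open>Equality in Cauchy-Schwarz: \<open>R11 *\<^sub>v (x + W *\<^sub>v y)\<close> has to be the multiple of row \<open>i\<close> of \<open>V\<close> that gives
  \<open>x\<close> the prescribed entry \<open>b\<close>.\<close>

lemma column_distance_attained:
  assumes i: "i < k" and j: "j < q"
  obtains x where "x \<in> carrier_vec k" "x $ i = b"
    "\<omega>sq i * ((R *\<^sub>v (x @\<^sub>v c \<cdot>\<^sub>v unit_vec q j)) \<bullet> (R *\<^sub>v (x @\<^sub>v c \<cdot>\<^sub>v unit_vec q j))) =
      (b + c * W $$ (i, j))\<^sup>2 + c\<^sup>2 * (\<omega>sq i * \<gamma>sq j)"
proof -
  let ?y = "c \<cdot>\<^sub>v unit_vec q j"
  define s where "s = b + c * W $$ (i, j)"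
  define z where "z = (s / \<omega>sq i) \<cdot>\<^sub>v row V i"
  define x where "x = V *\<^sub>v z - W *\<^sub>v ?y"
  have y: "?y \<in> carrier_vec q" by simp
  have z: "z \<in> carrier_vec k" using V by (auto simp: z_def)
  have Vz: "V *\<^sub>v z \<in> carrier_vec k" by (rule mult_mat_vec_carrier[OF V z])
  have Wy: "W *\<^sub>v ?y \<in> carrier_vec k" by (rule mult_mat_vec_carrier[OF W y])
  have x: "x \<in> carrier_vec k" using Vz Wy by (simp add: x_def)
  have xW: "x + W *\<^sub>v ?y = V *\<^sub>v z" unfolding x_def by (rule vec_diff_add_cancel[OF Vz Wy])
  have "(V *\<^sub>v z) $ i = row V i \<bullet> z" using V i by simp
  also have "\<dots> = s"
    using \<omega>sq_pos[OF i] V by (simp add: z_def \<omega>sq_def)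
  finally have xi: "x $ i = b"
    using i W W_unit_index[OF i j, of c] Wy unfolding x_def s_def
    by (simp del: index_mult_mat_vec)
  have zz: "\<omega>sq i * (z \<bullet> z) = s\<^sup>2"
    using \<omega>sq_pos[OF i] V by (simp add: z_def \<omega>sq_def power2_eq_square)
  show ?thesis
  proof (rule that[OF x xi])
    show "\<omega>sq i * ((R *\<^sub>v (x @\<^sub>v ?y)) \<bullet> (R *\<^sub>v (x @\<^sub>v ?y))) =
      (b + c * W $$ (i, j))\<^sup>2 + c\<^sup>2 * (\<omega>sq i * \<gamma>sq j)"
      unfolding sq_R_vec[OF x y] sq_R22_unit[OF j] xW R11V_vec[OF z] using zz
      by (simp add: s_def algebra_simps)
  qed
qed

subsection \<open>Singular values of the diagonal blocks\<close>

text \<open>The square of a bound for the factor by which the singular values of the diagonal blocks differ from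
  those of \<open>R\<close>. Expanding the last product over rows of \<open>V\<close> and columns of \<open>R22\<close> shows that it is one
  plus the sum of all \<open>rho_sq i j\<close>.\<close>

definition stretch_sq :: real where "stretch_sq = 1 + frob_sq W + frob_sq V * frob_sq R22"

lemma stretch_sq_le:
  assumes "\<And>i j. i < k \<Longrightarrow> j < q \<Longrightarrow> rho_sq i j \<le> F"
  shows "stretch_sq \<le> 1 + F * real (k * q)"
proof -
  have "frob_sq V * frob_sq R22 = (\<Sum>i<k. \<Sum>j<q. \<omega>sq i * \<gamma>sq j)"
    unfolding frob_sq_cols[OF R22] frob_sq_def[of V] using V
    by (simp add: sum_product \<omega>sq_def \<gamma>sq_def)
  then have "stretch_sq = 1 + (\<Sum>i<k. \<Sum>j<q. rho_sq i j)"
    unfolding stretch_sq_def frob_sq_entries[OF W] rho_sq_def by (simp add: sum.distrib)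
  also have "\<dots> \<le> 1 + (\<Sum>i<k. \<Sum>j<q. F)"
    using assms by (intro add_left_mono sum_mono) auto
  finally show ?thesis by (simp add: algebra_simps)
qed

lemma stretch_sq_nonneg: "0 \<le> stretch_sq" and stretch_sq_ge_1: "1 \<le> stretch_sq"
  unfolding stretch_sq_def using frob_sq_nonneg[of W] frob_sq_nonneg[of V] frob_sq_nonneg[of R22] by auto

text \<open>It holds because a matrix cannot shrink a vector by more than the Frobenius norm of its inverse. It
  is what turns the product of the Frobenius norms of \<open>V\<close> and \<open>R22\<close> into an estimate of \<open>R22\<close>
  against the singular values of \<open>R11\<close>.\<close>

lemma singular_value_R11_lower:
  assumes i: "1 \<le> i" "i \<le> k"
  shows "1 \<le> frob_sq V * (singular_value R11 i)\<^sup>2"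
proof -
  obtain C where C: "C \<in> carrier_mat (i - 1) k" and Cx: "\<And>x. x \<in> carrier_vec k \<Longrightarrow> C *\<^sub>v x = 0\<^sub>v (i - 1) \<Longrightarrow>
      (R11 *\<^sub>v x) \<bullet> (R11 *\<^sub>v x) \<le> (singular_value R11 i)\<^sup>2 * (x \<bullet> x)"
    using singular_value_upper_subspace[OF R11 i] by blast
  have "i - 1 < k" using i by simp
  then obtain x where x: "x \<in> carrier_vec k" "x \<noteq> 0\<^sub>v k" "C *\<^sub>v x = 0\<^sub>v (i - 1)"
    using wide_matrix_kernel[OF C] by blast
  have "x \<bullet> x \<le> frob_sq V * ((R11 *\<^sub>v x) \<bullet> (R11 *\<^sub>v x))"
    using sq_mult_mat_vec_le[OF V, of "R11 *\<^sub>v x"] R11 x VR11_vec[OF x(1)] by auto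
  also have "\<dots> \<le> frob_sq V * ((singular_value R11 i)\<^sup>2 * (x \<bullet> x))"
    by (intro mult_left_mono Cx x frob_sq_nonneg)
  finally show ?thesis using sq_pos[OF x(1,2)] by simp
qed

text \<open>Test space for \<open>R11\<close>: the vectors \<open>x\<close> such that \<open>x\<close> padded by zeros lies in the extremal space of \<open>R\<close>.\<close>

lemma singular_value_R11_le_R:
  assumes i: "1 \<le> i" "i \<le> k"
  shows "singular_value R11 i \<le> singular_value R i"
proof -
  obtain C where C: "C \<in> carrier_mat (i - 1) (k + q)"
    and Cz: "\<And>z. z \<in> carrier_vec (k + q) \<Longrightarrow> C *\<^sub>v z = 0\<^sub>v (i - 1) \<Longrightarrow>
      (R *\<^sub>v z) \<bullet> (R *\<^sub>v z) \<le> (singular_value R i)\<^sup>2 * (z \<bullet> z)"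
    using singular_value_upper_subspace[OF R, of i] i by (meson trans_le_add1)
  define E :: "real mat" where "E = 1\<^sub>m k @\<^sub>r 0\<^sub>m q k"
  have E: "E \<in> carrier_mat (k + q) k" by (simp add: E_def)
  have Ex: "E *\<^sub>v x = x @\<^sub>v 0\<^sub>v q" if "x \<in> carrier_vec k" for x
    unfolding E_def using that
    by (simp add: mat_mult_append[OF one_carrier_mat zero_carrier_mat] zero_mat_mult_vec)
  show ?thesis
  proof (rule singular_value_le[OF R11 i(1) singular_value_nonneg])
    show "C * E \<in> carrier_mat (i - 1) k" using C E by simp
    fix x assume x: "x \<in> carrier_vec k" and "(C * E) *\<^sub>v x = 0\<^sub>v (i - 1)"
    then have "C *\<^sub>v (x @\<^sub>v 0\<^sub>v q) = 0\<^sub>v (i - 1)"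
      using assoc_mult_mat_vec[OF C E x] Ex[OF x] by simp
    from Cz[OF _ this] x
    have "(R *\<^sub>v (x @\<^sub>v 0\<^sub>v q)) \<bullet> (R *\<^sub>v (x @\<^sub>v 0\<^sub>v q)) \<le> (singular_value R i)\<^sup>2 * (x \<bullet> x)"
      by (simp add: sq_append[OF x zero_carrier_vec[of q]])
    then show "(R11 *\<^sub>v x) \<bullet> (R11 *\<^sub>v x) \<le> (singular_value R i)\<^sup>2 * (x \<bullet> x)"
      unfolding sq_R_vec[OF x zero_carrier_vec] mat_mult_zero_vec[OF W] mat_mult_zero_vec[OF R22]
      using x by simp
  qed
qed

text \<open>Test space for \<open>R\<close>: \<open>x + W *\<^sub>v y = 0\<close>, \<open>k\<close> conditions that eliminate \<open>R11\<close>, and \<open>y\<close> in the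
  extremal space of \<open>R22\<close>, \<open>j - 1\<close> conditions more.\<close>

lemma singular_value_R_le_R22:
  assumes j: "1 \<le> j" "j \<le> q"
  shows "singular_value R (j + k) \<le> singular_value R22 j"
proof -
  obtain C where C: "C \<in> carrier_mat (j - 1) q"
    and Cy: "\<And>y. y \<in> carrier_vec q \<Longrightarrow> C *\<^sub>v y = 0\<^sub>v (j - 1) \<Longrightarrow>
      (R22 *\<^sub>v y) \<bullet> (R22 *\<^sub>v y) \<le> (singular_value R22 j)\<^sup>2 * (y \<bullet> y)"
    using singular_value_upper_subspace[OF R22 j] by blast
  define D where "D = four_block_mat (1\<^sub>m k) W (0\<^sub>m (j - 1) k) C"
  have jk: "j + k - 1 = k + (j - 1)" using j by simp
  have D: "D \<in> carrier_mat (j + k - 1) (k + q)"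
    unfolding D_def jk by (rule four_block_carrier_mat[OF one_carrier_mat C])
  show ?thesis
  proof (rule singular_value_le[OF R _ singular_value_nonneg D])
    show "1 \<le> j + k" using j by simp
    fix z assume z: "z \<in> carrier_vec (k + q)" and Dz: "D *\<^sub>v z = 0\<^sub>v (j + k - 1)"
    obtain x y where x: "x \<in> carrier_vec k" and y: "y \<in> carrier_vec q" and zxy: "z = x @\<^sub>v y"
      using split_vec[OF z] .
    have Wy: "W *\<^sub>v y \<in> carrier_vec k" and Cyc: "C *\<^sub>v y \<in> carrier_vec (j - 1)" using W C y by auto
    have "D *\<^sub>v z = (x + W *\<^sub>v y) @\<^sub>v (C *\<^sub>v y)"
      unfolding D_def zxy using Cyc x
      by (subst four_block_mat_mult_vec[OF one_carrier_mat W zero_carrier_mat C x y])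
        (simp add: zero_mat_mult_vec[OF x])
    moreover have "0\<^sub>v (k + (j - 1)) = (0\<^sub>v k @\<^sub>v 0\<^sub>v (j - 1) :: real vec)"
      by (intro eq_vecI) auto
    ultimately have "(x + W *\<^sub>v y) @\<^sub>v (C *\<^sub>v y) = 0\<^sub>v k @\<^sub>v 0\<^sub>v (j - 1)"
      using Dz unfolding jk by metis
    moreover have "x + W *\<^sub>v y \<in> carrier_vec k" using x Wy by (rule add_carrier_vec)
    ultimately have 0: "x + W *\<^sub>v y = 0\<^sub>v k" "C *\<^sub>v y = 0\<^sub>v (j - 1)"
      using append_vec_eq[OF _ zero_carrier_vec] by blast+
    have "(R *\<^sub>v z) \<bullet> (R *\<^sub>v z) = (R22 *\<^sub>v y) \<bullet> (R22 *\<^sub>v y)"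
      unfolding zxy sq_R_vec[OF x y] 0(1) mat_mult_zero_vec[OF R11] by simp
    also have "\<dots> \<le> (singular_value R22 j)\<^sup>2 * (y \<bullet> y)" by (rule Cy[OF y 0(2)])
    also have "\<dots> \<le> (singular_value R22 j)\<^sup>2 * (z \<bullet> z)"
      unfolding zxy sq_append[OF x y] by (intro mult_left_mono) (auto simp: sq_nonneg)
    finally show "(R *\<^sub>v z) \<bullet> (R *\<^sub>v z) \<le> (singular_value R22 j)\<^sup>2 * (z \<bullet> z)" .
  qed
qed

text \<open>Test space for \<open>R\<close>: all \<open>(x, y)\<close> with \<open>x + W *\<^sub>v y\<close> in the extremal space of \<open>R11\<close> for its
  \<open>i\<close>-th singular value \<open>\<sigma>\<close>. There the \<open>R11\<close> part is at most \<open>\<sigma>\<^sup>2\<close> times the square of \<open>x + W *\<^sub>v y\<close>, and \<open>R22 *\<^sub>v y\<close> is absorbed because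
  \<open>frob_sq V * \<sigma>\<^sup>2 \<ge> 1\<close>.\<close>

lemma singular_value_R_le_R11:
  assumes i: "1 \<le> i" "i \<le> k"
  shows "singular_value R i \<le> sqrt stretch_sq * singular_value R11 i"
proof -
  let ?\<sigma> = "singular_value R11 i"
  obtain C where C: "C \<in> carrier_mat (i - 1) k" and Cx: "\<And>x. x \<in> carrier_vec k \<Longrightarrow> C *\<^sub>v x = 0\<^sub>v (i - 1) \<Longrightarrow>
      (R11 *\<^sub>v x) \<bullet> (R11 *\<^sub>v x) \<le> ?\<sigma>\<^sup>2 * (x \<bullet> x)"
    using singular_value_upper_subspace[OF R11 i] by blast
  define T where "T = mat k (k + q) (\<lambda>(a, b). if b < k then 1\<^sub>m k $$ (a, b) else W $$ (a, b - k))"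
  have T: "T \<in> carrier_mat k (k + q)" by (simp add: T_def)
  have Tz: "T *\<^sub>v (x @\<^sub>v y) = x + W *\<^sub>v y" if x: "x \<in> carrier_vec k" and y: "y \<in> carrier_vec q" for x y
  proof (rule eq_vecI)
    fix a assume "a < dim_vec (x + W *\<^sub>v y)"
    then have a: "a < k" using W by simp
    have "row T a = unit_vec k a @\<^sub>v row W a"
      using a W by (intro eq_vecI) (auto simp: T_def)
    then have "(T *\<^sub>v (x @\<^sub>v y)) $ a = unit_vec k a \<bullet> x + row W a \<bullet> y"
      using a T W x y by (simp add: scalar_prod_append[of _ k _ q])
    then show "(T *\<^sub>v (x @\<^sub>v y)) $ a = (x + W *\<^sub>v y) $ a" using a W x by simp
  qed (use T W in auto)
  show ?thesis
  proof (rule singular_value_le[OF R i(1)])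
    show "0 \<le> sqrt stretch_sq * ?\<sigma>" using stretch_sq_nonneg singular_value_nonneg[of R11 i] by simp
    show "C * T \<in> carrier_mat (i - 1) (k + q)" using C T by simp
    fix z assume z: "z \<in> carrier_vec (k + q)" and CTz: "(C * T) *\<^sub>v z = 0\<^sub>v (i - 1)"
    obtain x y where x: "x \<in> carrier_vec k" and y: "y \<in> carrier_vec q" and zxy: "z = x @\<^sub>v y"
      using split_vec[OF z] .
    define u where "u = x + W *\<^sub>v y"
    have Wy: "W *\<^sub>v y \<in> carrier_vec k" using W y by auto
    have u: "u \<in> carrier_vec k" using x Wy by (simp add: u_def)
    have "C *\<^sub>v u = 0\<^sub>v (i - 1)"
      using assoc_mult_mat_vec[OF C T z] CTz Tz[OF x y] by (simp add: zxy u_def)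
    from Cx[OF u this] have R11u: "(R11 *\<^sub>v u) \<bullet> (R11 *\<^sub>v u) \<le> ?\<sigma>\<^sup>2 * (u \<bullet> u)" .
    have "u \<bullet> u \<le> (1 + frob_sq W) * (x \<bullet> x + y \<bullet> y)"
      unfolding u_def
      by (rule sq_add_scaled_le[OF x Wy]) (auto simp: frob_sq_nonneg sq_nonneg sq_mult_mat_vec_le[OF W y])
    then have 1: "?\<sigma>\<^sup>2 * (u \<bullet> u) \<le> ?\<sigma>\<^sup>2 * ((1 + frob_sq W) * (z \<bullet> z))"
      unfolding zxy sq_append[OF x y] by (rule mult_left_mono) simp
    have "(R22 *\<^sub>v y) \<bullet> (R22 *\<^sub>v y) \<le> 1 * (frob_sq R22 * (y \<bullet> y))"
      using sq_mult_mat_vec_le[OF R22 y] by simp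
    also have "\<dots> \<le> (frob_sq V * ?\<sigma>\<^sup>2) * (frob_sq R22 * (y \<bullet> y))"
      using singular_value_R11_lower[OF i] by (intro mult_right_mono) (auto simp: frob_sq_nonneg sq_nonneg)
    also have "\<dots> \<le> (frob_sq V * ?\<sigma>\<^sup>2) * (frob_sq R22 * (z \<bullet> z))"
      unfolding zxy sq_append[OF x y] by (intro mult_left_mono) (auto simp: frob_sq_nonneg sq_nonneg)
    finally have 2: "(R22 *\<^sub>v y) \<bullet> (R22 *\<^sub>v y) \<le> (frob_sq V * ?\<sigma>\<^sup>2) * (frob_sq R22 * (z \<bullet> z))" .
    have "(R *\<^sub>v z) \<bullet> (R *\<^sub>v z) = (R11 *\<^sub>v u) \<bullet> (R11 *\<^sub>v u) + (R22 *\<^sub>v y) \<bullet> (R22 *\<^sub>v y)"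
      unfolding zxy u_def by (rule sq_R_vec[OF x y])
    also have "\<dots> \<le> stretch_sq * ?\<sigma>\<^sup>2 * (z \<bullet> z)"
      using R11u 1 2 unfolding stretch_sq_def by (simp add: algebra_simps)
    also have "\<dots> = (sqrt stretch_sq * ?\<sigma>)\<^sup>2 * (z \<bullet> z)"
      using stretch_sq_nonneg by (simp add: power_mult_distrib)
    finally show "(R *\<^sub>v z) \<bullet> (R *\<^sub>v z) \<le> (sqrt stretch_sq * ?\<sigma>)\<^sup>2 * (z \<bullet> z)" .
  qed
qed

text \<open>Test space for \<open>R\<close>: \<open>x + W *\<^sub>v y\<close> is arbitrary and \<open>y\<close> ranges over the extremal space of \<open>R22\<close> of
  dimension \<open>j\<close>, which makes dimension \<open>j + k\<close>. It is parametrised by \<open>u = x + W *\<^sub>v y\<close> and \<open>y = B *\<^sub>v t\<close>,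
  that is \<open>x = u - W *\<^sub>v (B *\<^sub>v t)\<close>.\<close>

lemma singular_value_R22_le_R:
  assumes j: "1 \<le> j" "j \<le> q"
  shows "singular_value R22 j \<le> sqrt stretch_sq * singular_value R (j + k)"
proof (cases "singular_value R22 j = 0")
  case True
  then show ?thesis using stretch_sq_nonneg singular_value_nonneg[of R "j + k"] by simp
next
  case False
  let ?\<tau> = "singular_value R22 j"
  have \<tau>: "?\<tau> > 0" using False singular_value_nonneg[of R22 j] by simp
  have jr: "j \<le> min r q" using False R22 unfolding singular_value_def by (auto split: if_splits)
  obtain B where B: "B \<in> carrier_mat q j"
    and Bt: "\<And>t. t \<in> carrier_vec j \<Longrightarrow> (B *\<^sub>v t) \<bullet> (B *\<^sub>v t) = t \<bullet> t"
      "\<And>t. t \<in> carrier_vec j \<Longrightarrow> ?\<tau>\<^sup>2 * (t \<bullet> t) \<le> (R22 *\<^sub>v (B *\<^sub>v t)) \<bullet> (R22 *\<^sub>v (B *\<^sub>v t))"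
    using singular_value_lower_subspace[OF R22 j(1) jr] by blast
  have \<tau>_le: "?\<tau>\<^sup>2 \<le> frob_sq R22"
  proof -
    let ?t = "unit_vec j 0 :: real vec"
    have t: "?t \<in> carrier_vec j" "?t \<bullet> ?t = 1" using j by auto
    have "?\<tau>\<^sup>2 \<le> (R22 *\<^sub>v (B *\<^sub>v ?t)) \<bullet> (R22 *\<^sub>v (B *\<^sub>v ?t))" using Bt(2)[OF t(1)] t by simp
    also have "\<dots> \<le> frob_sq R22 * ((B *\<^sub>v ?t) \<bullet> (B *\<^sub>v ?t))"
      by (rule sq_mult_mat_vec_le[OF R22]) (use B t in auto)
    finally show ?thesis using Bt(1)[OF t(1)] t by simp
  qed
  define N where "N = - (W * B)"
  have N: "N \<in> carrier_mat k j" using W B by (auto simp: N_def)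
  define F where "F = four_block_mat (1\<^sub>m k) N (0\<^sub>m q k) B"
  have F: "F \<in> carrier_mat (k + q) (j + k)" 
    unfolding F_def add.commute[of j k] by (rule four_block_carrier_mat[OF one_carrier_mat B])
  have Fut: "F *\<^sub>v (u @\<^sub>v t) = (u + - (W *\<^sub>v (B *\<^sub>v t))) @\<^sub>v (B *\<^sub>v t)"
    if u: "u \<in> carrier_vec k" and t: "t \<in> carrier_vec j" for u t
  proof -
    have "N *\<^sub>v t = - (W *\<^sub>v (B *\<^sub>v t))"
      unfolding N_def using W B t by (simp add: assoc_mult_mat_vec[OF W B t])
    moreover have "B *\<^sub>v t \<in> carrier_vec q" using B t by auto
    ultimately show ?thesis
      unfolding F_def using u by (simp add: four_block_mat_mult_vec[OF one_carrier_mat N zero_carrier_mat B u t] zero_mat_mult_vec[OF u])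
  qed
  have split: "\<exists>u t. u \<in> carrier_vec k \<and> t \<in> carrier_vec j \<and> w = u @\<^sub>v t" if "w \<in> carrier_vec (j + k)" for w :: "real vec"
    using split_vec[of w k j] that by (metis add.commute)
  have scaled: "?\<tau> / sqrt stretch_sq \<le> singular_value R (j + k)"
  proof (rule singular_value_ge[OF R _ _ F])
    show "1 \<le> j + k" "j + k \<le> k + q" using j by auto
  next
    fix w :: "real vec" assume "w \<in> carrier_vec (j + k)" and Fw: "F *\<^sub>v w = 0\<^sub>v (k + q)"
    then obtain u t where u: "u \<in> carrier_vec k" and t: "t \<in> carrier_vec j" and w: "w = u @\<^sub>v t" using split by blast
    have y: "B *\<^sub>v t \<in> carrier_vec q" and Wy: "W *\<^sub>v (B *\<^sub>v t) \<in> carrier_vec k" using B W t by auto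
    have "(u + - (W *\<^sub>v (B *\<^sub>v t))) @\<^sub>v (B *\<^sub>v t) = 0\<^sub>v k @\<^sub>v 0\<^sub>v q"
      using Fut[OF u t] Fw by (auto simp: w)
    moreover have "u + - (W *\<^sub>v (B *\<^sub>v t)) \<in> carrier_vec k" using u Wy by simp
    ultimately have 0: "u + - (W *\<^sub>v (B *\<^sub>v t)) = 0\<^sub>v k" "B *\<^sub>v t = 0\<^sub>v q"
      using append_vec_eq[OF _ zero_carrier_vec] by blast+
    have "t \<bullet> t = 0" using Bt(1)[OF t] 0(2) by simp
    then have t0: "t = 0\<^sub>v j" using sq_eq_0_iff[OF t] by simp
    have "u + - 0\<^sub>v k = 0\<^sub>v k" using 0(1) unfolding 0(2) mat_mult_zero_vec[OF W] .
    then have "u = 0\<^sub>v k" using u by simp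
    then show "w = 0\<^sub>v (j + k)" using t0 by (auto simp: w add.commute)
  next
    fix w :: "real vec" assume "w \<in> carrier_vec (j + k)"
    then obtain u t where u: "u \<in> carrier_vec k" and t: "t \<in> carrier_vec j" and w: "w = u @\<^sub>v t" using split by blast
    define y where "y = B *\<^sub>v t"
    have y: "y \<in> carrier_vec q" using B t by (auto simp: y_def)
    have Wy: "W *\<^sub>v y \<in> carrier_vec k" "- (W *\<^sub>v y) \<in> carrier_vec k" using W y by auto
    define x where "x = u + - (W *\<^sub>v y)"
    have x: "x \<in> carrier_vec k" using u Wy by (simp add: x_def)
    have xW: "x + W *\<^sub>v y = u"
      using u Wy vec_diff_add_cancel[OF u Wy(1)] by (simp add: x_def minus_add_uminus_vec[OF u Wy(1)])
    have Fw: "F *\<^sub>v w = x @\<^sub>v y" unfolding w x_def y_def by (rule Fut[OF u t])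
    have Rw: "(R *\<^sub>v (F *\<^sub>v w)) \<bullet> (R *\<^sub>v (F *\<^sub>v w)) = (R11 *\<^sub>v u) \<bullet> (R11 *\<^sub>v u) + (R22 *\<^sub>v y) \<bullet> (R22 *\<^sub>v y)"
      unfolding Fw sq_R_vec[OF x y] xW ..
    let ?a = "(R11 *\<^sub>v u) \<bullet> (R11 *\<^sub>v u)"
    have "u \<bullet> u \<le> frob_sq V * ?a"
      using sq_mult_mat_vec_le[OF V mult_mat_vec_carrier[OF R11 u]] VR11_vec[OF u] by simp
    then have uu: "u \<bullet> u \<le> (frob_sq V * ?\<tau>\<^sup>2) * (?a / ?\<tau>\<^sup>2)" using \<tau> by simp
    have Wyy: "(- (W *\<^sub>v y)) \<bullet> (- (W *\<^sub>v y)) \<le> frob_sq W * (y \<bullet> y)"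
      using sq_mult_mat_vec_le[OF W y] Wy by simp
    have "x \<bullet> x \<le> (frob_sq V * ?\<tau>\<^sup>2 + frob_sq W) * (?a / ?\<tau>\<^sup>2 + y \<bullet> y)"
      unfolding x_def
      by (rule sq_add_scaled_le[OF u Wy(2) _ _ uu Wyy]) (auto simp: frob_sq_nonneg sq_nonneg)
    also have "\<dots> \<le> (frob_sq V * frob_sq R22 + frob_sq W) * (?a / ?\<tau>\<^sup>2 + y \<bullet> y)"
      using \<tau>_le by (intro mult_right_mono add_mono mult_left_mono) (auto simp: frob_sq_nonneg sq_nonneg)
    finally have "x \<bullet> x + y \<bullet> y \<le> (frob_sq V * frob_sq R22 + frob_sq W) * (?a / ?\<tau>\<^sup>2 + y \<bullet> y)
        + (?a / ?\<tau>\<^sup>2 + y \<bullet> y)"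
      by (intro add_mono) (auto simp: sq_nonneg)
    then have "x \<bullet> x + y \<bullet> y \<le> stretch_sq * (?a / ?\<tau>\<^sup>2 + y \<bullet> y)"
      unfolding stretch_sq_def by (simp only: distrib_right mult_1 add_ac)
    then have "?\<tau>\<^sup>2 * (x \<bullet> x + y \<bullet> y) \<le> ?\<tau>\<^sup>2 * (stretch_sq * (?a / ?\<tau>\<^sup>2 + y \<bullet> y))"
      by (rule mult_left_mono) simp
    also have "\<dots> = stretch_sq * (?a + ?\<tau>\<^sup>2 * (y \<bullet> y))" using \<tau> by (simp add: field_simps)
    also have "\<dots> \<le> stretch_sq * ((R *\<^sub>v (F *\<^sub>v w)) \<bullet> (R *\<^sub>v (F *\<^sub>v w)))"
      unfolding Rw using Bt[OF t] stretch_sq_nonneg by (intro mult_left_mono) (auto simp: y_def)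
    finally show "(?\<tau> / sqrt stretch_sq)\<^sup>2 * ((F *\<^sub>v w) \<bullet> (F *\<^sub>v w)) \<le> (R *\<^sub>v (F *\<^sub>v w)) \<bullet> (R *\<^sub>v (F *\<^sub>v w))"
      unfolding Fw sq_append[OF x y] using stretch_sq_ge_1
      by (simp add: power_divide divide_le_eq mult.commute)
  qed
  then show ?thesis using stretch_sq_ge_1 by (simp add: divide_le_eq mult.commute)
qed

end

section \<open>Transferring rho through a subspace embedding\<close>

text \<open>Each of the two squared distances whose quotient is \<open>rho_sq i j\<close> is the minimum of a quadratic form
  over an affine space that does not depend on the form, so a relative perturbation of the form changes
  it by a factor between \<open>1 - \<epsilon>\<close> and \<open>1 + \<epsilon>\<close>. It suffices to compare the minimiser of one form with the minimum of the other:
  \<open>x\<close> is optimal for the numerator of \<open>B\<close>, and \<open>y\<close> for the denominator of \<open>A\<close>.\<close>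

lemma rho_sq_quasi_isometry:
  assumes A: "block_triangular A11 VA A12 A22 k q r" and B: "block_triangular B11 VB B12 B22 k q s"
    and eps: "\<epsilon> < 1"
    and iso: "\<And>z. z \<in> carrier_vec (k + q) \<Longrightarrow>
      (1 - \<epsilon>) * ((RA *\<^sub>v z) \<bullet> (RA *\<^sub>v z)) \<le> (RB *\<^sub>v z) \<bullet> (RB *\<^sub>v z) \<and>
      (RB *\<^sub>v z) \<bullet> (RB *\<^sub>v z) \<le> (1 + \<epsilon>) * ((RA *\<^sub>v z) \<bullet> (RA *\<^sub>v z))"
    and RA: "RA = block_triangular.R A11 A12 A22 k r" and RB: "RB = block_triangular.R B11 B12 B22 k s"
    and ij: "i < k" "j < q"
  shows "block_triangular.rho_sq VA A12 A22 i j \<le>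
    (1 + \<epsilon>) / (1 - \<epsilon>) * block_triangular.rho_sq VB B12 B22 i j"
proof -
  interpret A: block_triangular A11 VA A12 A22 k q r by (rule A)
  interpret B: block_triangular B11 VB B12 B22 k q s by (rule B)
  let ?z = "\<lambda>x c. x @\<^sub>v c \<cdot>\<^sub>v unit_vec q j"
  let ?nA = "\<lambda>z. (RA *\<^sub>v z) \<bullet> (RA *\<^sub>v z)" and ?nB = "\<lambda>z. (RB *\<^sub>v z) \<bullet> (RB *\<^sub>v z)"
  obtain x where x: "x \<in> carrier_vec k" "x $ i = 0" and Bx: "B.\<omega>sq i * ?nB (?z x 1) = B.rho_sq i j"
    using B.column_distance_attained[OF ij, of 0 1] unfolding RB B.rho_sq_def by auto
  have Ax: "A.rho_sq i j \<le> A.\<omega>sq i * ?nA (?z x 1)"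
    using A.column_distance_le[OF ij x, of 1] unfolding RA A.rho_sq_def by simp
  obtain y where y: "y \<in> carrier_vec k" "y $ i = 1" and Ay: "A.\<omega>sq i * ?nA (?z y 0) = 1"
    using A.column_distance_attained[OF ij, of 1 0] unfolding RA by auto
  have By: "1 \<le> B.\<omega>sq i * ?nB (?z y 0)"
    using B.column_distance_le[OF ij y, of 0] unfolding RB by simp
  have z: "?z x 1 \<in> carrier_vec (k + q)" "?z y 0 \<in> carrier_vec (k + q)" using x y by auto
  have pos: "0 < A.\<omega>sq i" "0 < B.\<omega>sq i" using A.\<omega>sq_pos[OF ij(1)] B.\<omega>sq_pos[OF ij(1)] by auto
  have "A.\<omega>sq i * 1 \<le> A.\<omega>sq i * (B.\<omega>sq i * ((1 + \<epsilon>) * ?nA (?z y 0)))"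
    using By iso[OF z(2)] pos by (meson mult_left_mono less_imp_le order_trans)
  also have "\<dots> = B.\<omega>sq i * (1 + \<epsilon>) * (A.\<omega>sq i * ?nA (?z y 0))" by (simp only: mult_ac)
  finally have \<omega>: "A.\<omega>sq i \<le> B.\<omega>sq i * (1 + \<epsilon>)" by (simp add: Ay)
  have "(1 - \<epsilon>) * A.rho_sq i j \<le> (1 - \<epsilon>) * (A.\<omega>sq i * ?nA (?z x 1))"
    using Ax eps by (intro mult_left_mono) auto
  also have "\<dots> = A.\<omega>sq i * ((1 - \<epsilon>) * ?nA (?z x 1))" by (simp only: mult_ac)
  also have "\<dots> \<le> A.\<omega>sq i * ?nB (?z x 1)"
    using iso[OF z(1)] pos by (intro mult_left_mono) auto
  also have "\<dots> \<le> B.\<omega>sq i * (1 + \<epsilon>) * ?nB (?z x 1)"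
    using \<omega> by (intro mult_right_mono sq_nonneg)
  also have "\<dots> = (1 + \<epsilon>) * B.rho_sq i j" unfolding Bx[symmetric] by (simp only: mult_ac)
  finally show ?thesis using eps by (simp add: pos_le_divide_eq mult.commute)
qed

lemma embedding_sq_bounds:
  assumes emb: "eps_embedding d m \<epsilon> \<Omega> X" and x: "x \<in> X"
  shows "(1 - \<epsilon>) * (x \<bullet> x) \<le> (\<Omega> *\<^sub>v x) \<bullet> (\<Omega> *\<^sub>v x) \<and> (\<Omega> *\<^sub>v x) \<bullet> (\<Omega> *\<^sub>v x) \<le> (1 + \<epsilon>) * (x \<bullet> x)"
proof -
  have "\<bar>(\<Omega> *\<^sub>v x) \<bullet> (\<Omega> *\<^sub>v x) - x \<bullet> x\<bar> \<le> \<epsilon> * norm2 x * norm2 x"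
    using emb x unfolding eps_embedding_def by blast
  also have "\<dots> = \<epsilon> * (x \<bullet> x)"
    by (simp only: norm2_sq[symmetric] power2_eq_square mult.assoc)
  finally show ?thesis by (auto simp: algebra_simps abs_le_iff)
qed

section \<open>Factorizations, permutations and inverses\<close>

lemma permutation_matrix_orthonormal:
  assumes "permutation_matrix n P"
  shows "orthonormal_matrix n P"
proof -
  from assms obtain \<pi> where \<pi>: "\<pi> permutes {..<n}" and P: "P = mat n n (\<lambda>(i, j). if i = \<pi> j then 1 else 0)"
    unfolding permutation_matrix_def by blast
  have Pc: "P \<in> carrier_mat n n" by (simp add: P)
  have "P\<^sup>T * P = 1\<^sub>m n"
  proof (rule eq_matI)
    fix i j assume "i < dim_row (1\<^sub>m n)" "j < dim_col (1\<^sub>m n)"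
    then have ij: "i < n" "j < n" by auto
    have "(P\<^sup>T * P) $$ (i, j) = (\<Sum>l<n. (if l = \<pi> i then 1 else 0) * (if l = \<pi> j then 1 else 0))"
      using ij by (simp add: P scalar_prod_def atLeast0LessThan)
    also have "\<dots> = (\<Sum>l<n. if l = \<pi> i then (if \<pi> i = \<pi> j then 1 else 0) else 0)"
      by (rule sum.cong) auto
    also have "\<dots> = (if \<pi> i = \<pi> j then 1 else 0)"
      using permutes_in_image[OF \<pi>, of i] ij by simp
    also have "\<dots> = (1\<^sub>m n :: real mat) $$ (i, j)"
      using permutes_inj[OF \<pi>] ij by (simp add: inj_eq)
    finally show "(P\<^sup>T * P) $$ (i, j) = 1\<^sub>m n $$ (i, j)" .
  qed (use Pc in auto)
  then show ?thesis
    unfolding orthonormal_matrix_def using Pc mat_mult_left_right_inverse[of "P\<^sup>T" n P] by auto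
qed

text \<open>The Gram matrices of \<open>A\<close> and \<open>R\<close> are conjugate by \<open>P\<close>.\<close>

lemma singular_value_orthonormal_factors:
  assumes A: "A \<in> carrier_mat p n" and R: "R \<in> carrier_mat p n"
    and P: "orthonormal_matrix n P" and Q: "orthonormal_matrix p Q" and AP: "A * P = Q * R"
  shows "singular_value A = singular_value R"
proof -
  have Pc: "P \<in> carrier_mat n n" "P * P\<^sup>T = 1\<^sub>m n" "P\<^sup>T * P = 1\<^sub>m n" and Qc: "Q \<in> carrier_mat p p" "Q\<^sup>T * Q = 1\<^sub>m p"
    using P Q by (auto simp: orthonormal_matrix_def)
  have QR: "Q * R \<in> carrier_mat p n" using Qc R by auto
  have T: "R\<^sup>T \<in> carrier_mat n p" "Q\<^sup>T \<in> carrier_mat p p" using R Qc by auto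
  have "R\<^sup>T * R = R\<^sup>T * ((Q\<^sup>T * Q) * R)" by (simp only: Qc(2) left_mult_one_mat[OF R])
  also have "\<dots> = R\<^sup>T * (Q\<^sup>T * (Q * R))" by (simp only: assoc_mult_mat[OF T(2) Qc(1) R])
  also have "\<dots> = (R\<^sup>T * Q\<^sup>T) * (Q * R)" by (rule assoc_mult_mat[OF T QR, symmetric])
  also have "\<dots> = (A * P)\<^sup>T * (A * P)" unfolding AP by (simp add: transpose_mult[OF Qc(1) R])
  also have "\<dots> = P\<^sup>T * (A\<^sup>T * A) * P"
    using A Pc by (simp add: transpose_mult[OF A Pc(1)] assoc_mult_mat[of _ n n _ p _ n]
      assoc_mult_mat[of _ n p _ n _ n] assoc_mult_mat[of _ n n _ n _ n])
  finally have "R\<^sup>T * R = P\<^sup>T * (A\<^sup>T * A) * P" .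
  then have "similar_mat_wit (R\<^sup>T * R) (A\<^sup>T * A) (P\<^sup>T) P"
    by (intro similar_mat_witI[of _ _ n]) (use A R Pc in auto)
  then have "char_poly (R\<^sup>T * R) = char_poly (A\<^sup>T * A)"
    by (intro char_poly_similar) (auto simp: similar_mat_def)
  then show ?thesis using A R unfolding singular_value_def by (intro ext) simp
qed

lemma minv_inverse:
  assumes A: "A \<in> carrier_mat k k" and inv: "invertible_mat A"
  shows "minv A \<in> carrier_mat k k" "A * minv A = 1\<^sub>m k" "minv A * A = 1\<^sub>m k"
proof -
  obtain B where B: "inverts_mat A B" "inverts_mat B A" using inv unfolding invertible_mat_def by blast
  have AB: "A * B = 1\<^sub>m k" using B A by (simp add: inverts_mat_def)
  have "dim_col (B * A) = dim_row B" using B(2) by (simp add: inverts_mat_def)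
  moreover have "dim_col (A * B) = k" unfolding AB by simp
  ultimately have Bc: "B \<in> carrier_mat k k" using A by auto
  have "B * A = 1\<^sub>m k" using B Bc by (simp add: inverts_mat_def)
  then have "A \<in> Units (ring_mat TYPE(real) k ())"
    using A Bc AB unfolding Units_def by (auto simp: ring_mat_simps)
  then obtain C where "mat_inverse A = Some C" using mat_inverse(1)[OF A, of "()"] by (cases "mat_inverse A") auto
  then show "minv A \<in> carrier_mat k k" "A * minv A = 1\<^sub>m k" "minv A * A = 1\<^sub>m k"
    using mat_inverse(2)[OF A] by auto
qed

lemma invertible_mat_if_injective:
  fixes A :: "real mat"
  assumes A: "A \<in> carrier_mat k k" and inj: "\<And>x. x \<in> carrier_vec k \<Longrightarrow> A *\<^sub>v x = 0\<^sub>v k \<Longrightarrow> x = 0\<^sub>v k"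
  shows "invertible_mat A"
proof -
  have "det A \<noteq> 0" using det_0_iff_vec_prod_zero[OF A] inj by blast
  from det_non_zero_imp_unit[OF A this, of "()"]
  obtain B where "B \<in> carrier_mat k k" "A * B = 1\<^sub>m k" "B * A = 1\<^sub>m k"
    unfolding Units_def by (auto simp: ring_mat_simps)
  then show ?thesis using A unfolding invertible_mat_def inverts_mat_def by auto
qed

lemma partial_QR_blocks:
  assumes qr: "partial_QR k A Q R" and A: "A \<in> carrier_mat (k + r) (k + q)"
    and blocks: "split_block R k k = (R11, R12, R21, R22)"
  shows "R11 \<in> carrier_mat k k" "R12 \<in> carrier_mat k q" "R22 \<in> carrier_mat r q"
    "R = four_block_mat R11 R12 (0\<^sub>m r k) R22" "R \<in> carrier_mat (k + r) (k + q)"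
    "orthonormal_matrix (k + r) Q" "A = Q * R"
proof -
  have d: "dim_row A = k + r" "dim_col A = k + q" using A by auto
  have R: "R \<in> carrier_mat (k + r) (k + q)" and R21: "R21 = 0\<^sub>m r k"
    using qr unfolding partial_QR_def blocks d by auto
  then have "dim_row R = k + r" "dim_col R = k + q" by auto
  note s = split_block[OF blocks this]
  show "R11 \<in> carrier_mat k k" "R12 \<in> carrier_mat k q" "R22 \<in> carrier_mat r q"
    "R = four_block_mat R11 R12 (0\<^sub>m r k) R22" using s unfolding R21 by auto
  show "R \<in> carrier_mat (k + r) (k + q)" by (rule R)
  show "orthonormal_matrix (k + r) Q" "A = Q * R"
    using qr unfolding partial_QR_def d by auto
qed

lemma rho_entry_le:
  assumes "split_block R k k = (R11, R12, R21, R22)" and "rho R k \<le> f" and "i < k" "j < dim_col R - k"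
  shows "((minv R11 * R12) $$ (i, j))\<^sup>2 + (norm2 (row (minv R11) i))\<^sup>2 * (norm2 (col R22 j))\<^sup>2 \<le> f\<^sup>2"
    (is "?e i j \<le> _")
proof -
  let ?S = "{sqrt (?e i j) | i j. i < k \<and> j < dim_col R - k}"
  have "?S = (\<lambda>(i, j). sqrt (?e i j)) ` ({..<k} \<times> {..<dim_col R - k})" by auto
  then have "finite ?S" by simp
  moreover have "sqrt (?e i j) \<in> ?S" using assms(3,4) by blast
  ultimately have "sqrt (?e i j) \<le> Max ?S" by (rule Max_ge)
  also have "\<dots> \<le> f" using assms(2) unfolding rho_def assms(1) by simp
  finally have "sqrt (?e i j) \<le> f" .
  then show ?thesis by (rule sqrt_le_D)
qed

section \<open>Strong rank-revealing QR from a sketch\<close>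

theorem theorem4p1:
  fixes M \<Omega> P Q R Qsk Rsk R11 R12 R21 R22 :: "real mat"
    and m n d k :: nat and \<epsilon> f ft :: real
  assumes M: "M \<in> carrier_mat m n"
    and eps: "0 \<le> \<epsilon>" "\<epsilon> < 1"
    and emb: "eps_embedding d m \<epsilon> \<Omega> (mat_range M)"
    and f: "f > 1"
    and k: "1 \<le> k" "k \<le> min m d" "k < n"
    and sk: "strong_RRQR k f (\<Omega> * M) P Qsk Rsk"
    and qr: "partial_QR k (M * P) Q R"
    and blocks: "split_block R k k = (R11, R12, R21, R22)"
    and ft: "ft = sqrt ((1 + \<epsilon>) / (1 - \<epsilon>)) * f"
  shows "invertible_mat R11 \<and>
    (\<forall>i\<in>{1..k}. \<forall>j\<in>{1..n - k}.
       1 \<le> singular_value M i / singular_value R11 i \<and>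
       singular_value M i / singular_value R11 i \<le> sqrt (1 + ft\<^sup>2 * real (k * (n - k))) \<and>
       (singular_value M (j + k) \<noteq> 0 \<longrightarrow>
          1 \<le> singular_value R22 j / singular_value M (j + k) \<and>
          singular_value R22 j / singular_value M (j + k) \<le> sqrt (1 + ft\<^sup>2 * real (k * (n - k)))) \<and>
       (singular_value M (j + k) = 0 \<longrightarrow> singular_value R22 j = 0) \<and>
       \<bar>(minv R11 * R12) $$ (i - 1, j - 1)\<bar> \<le> ft)"
proof -
  define q r s where "q = n - k" and "r = m - k" and "s = d - k"
  have dims: "n = k + q" "m = k + r" "d = k + s" using k by (auto simp: q_def r_def s_def)
  have \<Omega>: "\<Omega> \<in> carrier_mat d m" using emb unfolding eps_embedding_def by simp
  have P: "orthonormal_matrix n P" and qr_sk: "partial_QR k (\<Omega> * M * P) Qsk Rsk"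
    and inv_sk: "invertible_mat (fst (split_block Rsk k k))" and rho_sk: "rho Rsk k \<le> f"
    using sk M permutation_matrix_orthonormal unfolding strong_RRQR_def by auto
  have Pc: "P \<in> carrier_mat n n" using P by (simp add: orthonormal_matrix_def)
  have MP: "M * P \<in> carrier_mat m n" and \<Omega>MP: "\<Omega> * M * P \<in> carrier_mat d n" using M \<Omega> Pc by auto
  obtain S11 S12 S21 S22 where blocks_sk: "split_block Rsk k k = (S11, S12, S21, S22)"
    by (metis surj_pair)
  note RB = partial_QR_blocks[OF qr MP[unfolded dims] blocks]
  note SB = partial_QR_blocks[OF qr_sk \<Omega>MP[unfolded dims] blocks_sk]
  have "invertible_mat S11" using inv_sk unfolding blocks_sk by simp
  note S_inv = minv_inverse[OF SB(1) this]
  interpret S: block_triangular S11 "minv S11" S12 S22 k q s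
    using SB S_inv by unfold_locales auto
  have Rsk: "Rsk = S.R" unfolding S.R_def by (rule SB(4))
  \<comment> \<open>Up to orthogonal factors, \<open>R *\<^sub>v z\<close> is a vector of the range of \<open>M\<close> and \<open>Rsk *\<^sub>v z\<close> its sketch.\<close>
  have iso: "(1 - \<epsilon>) * ((R *\<^sub>v z) \<bullet> (R *\<^sub>v z)) \<le> (Rsk *\<^sub>v z) \<bullet> (Rsk *\<^sub>v z) \<and>
      (Rsk *\<^sub>v z) \<bullet> (Rsk *\<^sub>v z) \<le> (1 + \<epsilon>) * ((R *\<^sub>v z) \<bullet> (R *\<^sub>v z))"
    if z: "z \<in> carrier_vec (k + q)" for z
  proof -
    have Pz: "P *\<^sub>v z \<in> carrier_vec n" by (rule mult_mat_vec_carrier[OF Pc]) (use z dims in simp)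
    define x where "x = M *\<^sub>v (P *\<^sub>v z)"
    have xM: "x \<in> mat_range M" unfolding mat_range_def x_def using Pz M by auto
    have Rz: "R *\<^sub>v z \<in> carrier_vec (k + r)" and Sz: "Rsk *\<^sub>v z \<in> carrier_vec (k + s)"
      using RB(5) SB(5) z by auto
    have zn: "z \<in> carrier_vec n" using z dims by simp
    have Qc: "Q \<in> carrier_mat (k + r) (k + r)" "Qsk \<in> carrier_mat (k + s) (k + s)"
      using RB(6) SB(6) by (auto simp: orthonormal_matrix_def)
    have "Q *\<^sub>v (R *\<^sub>v z) = (M * P) *\<^sub>v z"
      unfolding RB(7) by (rule assoc_mult_mat_vec[OF Qc(1) RB(5) z, symmetric])
    also have "\<dots> = x" unfolding x_def by (rule assoc_mult_mat_vec[OF M Pc zn])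
    finally have 1: "(R *\<^sub>v z) \<bullet> (R *\<^sub>v z) = x \<bullet> x"
      using orthonormal_sq(1)[OF RB(6) Rz] by simp
    have "Qsk *\<^sub>v (Rsk *\<^sub>v z) = (\<Omega> * M * P) *\<^sub>v z"
      unfolding SB(7) by (rule assoc_mult_mat_vec[OF Qc(2) SB(5) z, symmetric])
    also have "\<dots> = (\<Omega> * M) *\<^sub>v (P *\<^sub>v z)"
      by (rule assoc_mult_mat_vec[OF mult_carrier_mat[OF \<Omega> M] Pc zn])
    also have "\<dots> = \<Omega> *\<^sub>v x" unfolding x_def by (rule assoc_mult_mat_vec[OF \<Omega> M Pz])
    finally have 2: "(Rsk *\<^sub>v z) \<bullet> (Rsk *\<^sub>v z) = (\<Omega> *\<^sub>v x) \<bullet> (\<Omega> *\<^sub>v x)"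
      using orthonormal_sq(1)[OF SB(6) Sz] by simp
    show ?thesis unfolding 1 2 by (rule embedding_sq_bounds[OF emb xM])
  qed
  \<comment> \<open>The leading columns of the sketch are linearly independent, hence so are those of \<open>M * P\<close>.\<close>
  have invR: "invertible_mat R11"
  proof (rule invertible_mat_if_injective[OF RB(1)])
    fix x assume x: "x \<in> carrier_vec k" and R11x: "R11 *\<^sub>v x = 0\<^sub>v k"
    have "R *\<^sub>v (x @\<^sub>v 0\<^sub>v q) = 0\<^sub>v k @\<^sub>v 0\<^sub>v r"
      unfolding RB(4) four_block_mat_mult_vec[OF RB(1,2) zero_carrier_mat RB(3) x zero_carrier_vec]
        R11x mat_mult_zero_vec[OF RB(2)] mat_mult_zero_vec[OF RB(3)] zero_mat_mult_vec[OF x] by simp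
    then have "(R *\<^sub>v (x @\<^sub>v 0\<^sub>v q)) \<bullet> (R *\<^sub>v (x @\<^sub>v 0\<^sub>v q)) = 0"
      by (simp add: sq_append[of _ k _ r])
    then have "(S.R *\<^sub>v (x @\<^sub>v 0\<^sub>v q)) \<bullet> (S.R *\<^sub>v (x @\<^sub>v 0\<^sub>v q)) \<le> 0"
      using iso[of "x @\<^sub>v 0\<^sub>v q"] x unfolding Rsk by simp
    moreover have "x + 0\<^sub>v k = x" using x by simp
    ultimately have "(S11 *\<^sub>v x) \<bullet> (S11 *\<^sub>v x) \<le> 0"
      unfolding S.sq_R_vec[OF x zero_carrier_vec] mat_mult_zero_vec[OF S.W]
      using sq_nonneg[of "S22 *\<^sub>v 0\<^sub>v q"] by simp
    then have "(S11 *\<^sub>v x) \<bullet> (S11 *\<^sub>v x) = 0" using sq_nonneg[of "S11 *\<^sub>v x"] by linarith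
    then have "S11 *\<^sub>v x = 0\<^sub>v k"
      using sq_eq_0_iff[OF mult_mat_vec_carrier[OF SB(1) x]] by simp
    then show "x = 0\<^sub>v k"
      using S.VR11_vec[OF x] mat_mult_zero_vec[OF S_inv(1)] by simp
  qed
  note R_inv = minv_inverse[OF RB(1) invR]
  interpret A: block_triangular R11 "minv R11" R12 R22 k q r
    using RB R_inv by unfold_locales auto
  have R: "R = A.R" unfolding A.R_def by (rule RB(4))
  have ft_sq: "ft\<^sup>2 = (1 + \<epsilon>) / (1 - \<epsilon>) * f\<^sup>2"
    unfolding ft using eps by (simp add: power_mult_distrib)
  have ft_pos: "0 \<le> ft" unfolding ft using eps f by simp
  have rho: "A.rho_sq i j \<le> ft\<^sup>2" if ij: "i < k" "j < q" for i j
  proof -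
    have "j < dim_col Rsk - k" using SB(5) ij by simp
    from rho_entry_le[OF blocks_sk rho_sk ij(1) this] have "S.rho_sq i j \<le> f\<^sup>2"
      unfolding S.rho_sq_def S.W_def S.\<omega>sq_def S.\<gamma>sq_def by simp
    then have "(1 + \<epsilon>) / (1 - \<epsilon>) * S.rho_sq i j \<le> ft\<^sup>2"
      unfolding ft_sq using eps by (intro mult_left_mono) auto
    moreover have "A.rho_sq i j \<le> (1 + \<epsilon>) / (1 - \<epsilon>) * S.rho_sq i j"
      by (rule rho_sq_quasi_isometry[OF A.block_triangular_axioms S.block_triangular_axioms eps(2) iso R Rsk ij])
    ultimately show ?thesis by linarith
  qed
  have "A.stretch_sq \<le> 1 + ft\<^sup>2 * real (k * q)" by (rule A.stretch_sq_le) (rule rho)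
  then have stretch: "sqrt A.stretch_sq \<le> sqrt (1 + ft\<^sup>2 * real (k * q))" by simp
  have \<sigma>: "singular_value M = singular_value A.R"
    unfolding R[symmetric]
    by (rule singular_value_orthonormal_factors[of _ m n _ P Q]) (use M RB P dims in auto)
  show ?thesis
  proof (intro conjI invR ballI impI; unfold q_def[symmetric])
    fix i j assume ij: "i \<in> {1..k}" "j \<in> {1..q}"
    then have i: "1 \<le> i" "i \<le> k" and j: "1 \<le> j" "j \<le> q" by auto
    have pos: "0 < singular_value R11 i"
      using A.singular_value_R11_lower[OF i] singular_value_nonneg[of R11 i] by (cases "singular_value R11 i = 0") auto
    show "1 \<le> singular_value M i / singular_value R11 i"
      using A.singular_value_R11_le_R[OF i] pos by (simp add: \<sigma>)
    have "singular_value M i \<le> sqrt A.stretch_sq * singular_value R11 i"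
      unfolding \<sigma> by (rule A.singular_value_R_le_R11[OF i])
    also have "\<dots> \<le> sqrt (1 + ft\<^sup>2 * real (k * q)) * singular_value R11 i"
      using pos by (intro mult_right_mono stretch) simp
    finally show "singular_value M i / singular_value R11 i \<le> sqrt (1 + ft\<^sup>2 * real (k * q))"
      using pos by (simp add: pos_divide_le_eq)
    have upper: "singular_value R22 j \<le> sqrt (1 + ft\<^sup>2 * real (k * q)) * singular_value M (j + k)"
      using A.singular_value_R22_le_R[OF j] mult_right_mono[OF stretch singular_value_nonneg[of M "j + k"]]
      unfolding \<sigma> by (rule order_trans)
    show "singular_value R22 j = 0" if "singular_value M (j + k) = 0"
      using upper that singular_value_nonneg[of R22 j] by simp
    show "1 \<le> singular_value R22 j / singular_value M (j + k)"
      "singular_value R22 j / singular_value M (j + k) \<le> sqrt (1 + ft\<^sup>2 * real (k * q))"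
      if "singular_value M (j + k) \<noteq> 0"
    proof -
      have "0 < singular_value M (j + k)" using that singular_value_nonneg[of M "j + k"] by simp
      then show "1 \<le> singular_value R22 j / singular_value M (j + k)"
        "singular_value R22 j / singular_value M (j + k) \<le> sqrt (1 + ft\<^sup>2 * real (k * q))"
        using A.singular_value_R_le_R22[OF j] upper by (simp_all add: \<sigma> pos_divide_le_eq)
    qed
    have "((minv R11 * R12) $$ (i - 1, j - 1))\<^sup>2 \<le> A.rho_sq (i - 1) (j - 1)"
      unfolding A.rho_sq_def A.W_def A.\<omega>sq_def A.\<gamma>sq_def by (simp add: sq_nonneg)
    also have "\<dots> \<le> ft\<^sup>2" using i j by (intro rho) auto
    finally show "\<bar>(minv R11 * R12) $$ (i - 1, j - 1)\<bar> \<le> ft"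
      using ft_pos by (metis abs_le_square_iff abs_of_nonneg)
  qed
qed

end
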